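(* For any triangle-free planar graph $G$ on $n$ vertices and any $k\geq 6$ we have $\mathrm{diam}(\mathcal{C}_{k}(G))=\mathrm{Poly}(n)$, i.e. the diameter is bounded by a polynomial in $n$. Besides, there exists a triangle-free planar graph $G$ on $n$ vertices that does not admit any $\frac{\sqrt{n}}{2}$-partition of degree $3$.
   Context: A proper $k$-coloring of $G=(V,E)$ is a function $f:V\to\{1,\dots,k\}$ such that $f(x)\ne f(y)$ for every edge $xy\in E$. The $k$-recoloring graph $\mathcal{C}_k(G)$ is the graph whose vertices are the proper $k$-colorings of $G$, two colorings being adjacent if they differ on exactly one vertex of $G$. The diameter $\mathrm{diam}(\mathcal{C}_k(G))$ is the maximum distance between two vertices of $\mathcal{C}_k(G)$, the distance being infinite when there is no path. For a partition $\{V_1,\dots,V_t\}$ of $V$ into $t$ parts (ordered by index) let $G_i=G[\bigcup_{j\ge i}V_j]$ for every $i\le t$. It is a $t$-partition of degree $\ell$ of $G$ if, for every $i\le t$, every vertex $v\in V_i$ has degree at most $\ell$ in $G_i$. A $\frac{\sqrt{n}}{2}$-partition of degree $3$ is the case $t=\frac{\sqrt{n}}{2}$, $\ell=3$. *)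

theory Defs
  imports "HOL-Analysis.Analysis" "HOL-Computational_Algebra.Polynomial"
    "HOL-Library.Extended_Nat" "HOL-Library.FuncSet" "HOL-Library.Disjoint_Sets"
begin

type_synonym 'a graph = "'a set \<times> 'a set set"

abbreviation verts :: "'a graph \<Rightarrow> 'a set" where
  "verts G \<equiv> fst G"

abbreviation edges :: "'a graph \<Rightarrow> 'a set set" where
  "edges G \<equiv> snd G"

definition finite_simple_graph :: "'a graph \<Rightarrow> bool" where
  "finite_simple_graph G \<longleftrightarrow> finite (verts G) \<and> (\<forall>e\<in>edges G. e \<subseteq> verts G \<and> card e = 2)"

definition triangle_free :: "'a graph \<Rightarrow> bool" where
  "triangle_free G \<longleftrightarrow>
     \<not> (\<exists>x y z. {x, y} \<in> edges G \<and> {y, z} \<in> edges G \<and> {x, z} \<in> edges G)"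

(* The plane is the type complex. Each edge is drawn as an arc joining its two ends, and the
   interior of that arc contains no vertex and no point of any other edge. *)
definition planar :: "'a graph \<Rightarrow> bool" where
  "planar G \<longleftrightarrow>
     (\<exists>(p :: 'a \<Rightarrow> complex) (\<gamma> :: 'a set \<Rightarrow> real \<Rightarrow> complex).
        inj_on p (verts G) \<and>
        (\<forall>e\<in>edges G. arc (\<gamma> e) \<and> {pathstart (\<gamma> e), pathfinish (\<gamma> e)} = p ` e \<and>
           (path_image (\<gamma> e) - p ` e) \<inter> p ` verts G = {} \<and>
           (\<forall>e'\<in>edges G. e' \<noteq> e \<longrightarrow> (path_image (\<gamma> e) - p ` e) \<inter> path_image (\<gamma> e') = {})))"

definition induced :: "'a graph \<Rightarrow> 'a set \<Rightarrow> 'a graph" where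
  "induced G U = (U, {e \<in> edges G. e \<subseteq> U})"

definition vdegree :: "'a graph \<Rightarrow> 'a \<Rightarrow> nat" where
  "vdegree G v = card {e \<in> edges G. v \<in> e}"

definition walk :: "'a graph \<Rightarrow> 'a list \<Rightarrow> bool" where
  "walk G xs \<longleftrightarrow>
     xs \<noteq> [] \<and> set xs \<subseteq> verts G \<and> successively (\<lambda>x y. {x, y} \<in> edges G) xs"

(* A walk is given by its list of vertices, so its length is one less than that of the list.
   The infimum of the empty set is infinity. *)
definition graph_dist :: "'a graph \<Rightarrow> 'a \<Rightarrow> 'a \<Rightarrow> enat" where
  "graph_dist G u v = (INF xs \<in> {xs. walk G xs \<and> hd xs = u \<and> last xs = v}. enat (length xs - 1))"

definition graph_diam :: "'a graph \<Rightarrow> enat" where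
  "graph_diam G = (SUP u \<in> verts G. SUP v \<in> verts G. graph_dist G u v)"

(* Colorings are extensional (undefined outside the vertex set), so that each function
   from the vertex set to the colors is represented exactly once. *)
definition proper_colorings :: "nat \<Rightarrow> 'a graph \<Rightarrow> ('a \<Rightarrow> nat) set" where
  "proper_colorings k G =
     {f \<in> verts G \<rightarrow>\<^sub>E {1..k}. \<forall>x y. {x, y} \<in> edges G \<longrightarrow> f x \<noteq> f y}"

definition recoloring_graph :: "nat \<Rightarrow> 'a graph \<Rightarrow> ('a \<Rightarrow> nat) graph" where
  "recoloring_graph k G =
     (proper_colorings k G,
      {{f, g} | f g. f \<in> proper_colorings k G \<and> g \<in> proper_colorings k G \<and>
                     card {v \<in> verts G. f v \<noteq> g v} = 1})"

(* Injectivity of P together with partition_on says that the parts P 1, ..., P t are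
   nonempty and pairwise disjoint. *)
definition degree_partition :: "'a graph \<Rightarrow> nat \<Rightarrow> nat \<Rightarrow> (nat \<Rightarrow> 'a set) \<Rightarrow> bool" where
  "degree_partition G t l P \<longleftrightarrow>
     inj_on P {1..t} \<and> partition_on (verts G) (P ` {1..t}) \<and>
     (\<forall>i\<in>{1..t}. \<forall>v\<in>P i. vdegree (induced G (\<Union>j\<in>{i..t}. P j)) v \<le> l)"

end

theory Submission
  imports Defs
begin

text \<open>
  Polynomial diameter. The only property of triangle-free planar graphs that matters is that every
  subgraph on \<open>m\<close> vertices has at most \<open>2 m\<close> edges (\<open>planar_triangle_free_card_edges\<close>). Then a
  positive proportion of the vertices has degree at most 4, and a greedy choice among these gives
  an independent set \<open>I\<close> containing at least \<open>1/25\<close> of all the vertices. A sequence of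
  recolorings of \<open>G - I\<close> lifts to \<open>G\<close>: before a neighbor of \<open>v \<in> I\<close> receives the color of \<open>v\<close>,
  the vertex \<open>v\<close> moves away, which six colors allow because \<open>v\<close> avoids at most four colors of
  neighbors and one new color. So a vertex of \<open>I\<close> is recolored at most once per recoloring of one
  of its at most four neighbors, plus once at the end, and the number of recolorings per vertex grows by a
  factor of about 4 while the order shrinks at least by the factor \<open>24/25\<close>. There are logarithmically
  many rounds, which gives a power of \<open>n\<close>; since \<open>5 * 24 ^ 40 \<le> 25 ^ 40\<close>, the exponent 40 works per
  vertex (\<open>sparse_recolors\<close>), hence 41 in total.

  The edge bound is Euler's inequality for drawings whose edges are arbitrary arcs. Insert the
  edges one by one. An edge whose ends are already joined by a path in the drawing closes a Jordan
  curve, and so it creates a new face; any other edge merges two classes of vertices. Hence the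
  number \<open>F\<close> of faces is at least \<open>|E| - |V| + 2\<close> (\<open>euler_lower_bound\<close>). If there are at least two
  faces, then each has at least four edges on its frontier: otherwise the frontier would lie in at
  most three arcs and some vertices; the arcs form a forest since there are no triangles, and by Janiszewski's theorem
  a forest does not separate the plane (\<open>face_touches_four_edges\<close>). An arc lies on the frontier of
  at most two faces (\<open>edge_touched_by_two_faces\<close>). Double counting gives \<open>4 F \<le> 2 |E|\<close>.
  The bound of two faces per arc, without any regularity of the arc, comes from complex
  logarithms: \<open>(z - a) / (z - b)\<close> has a continuous logarithm on a compact set if \<open>a\<close> and \<open>b\<close> lie
  in the same component of the complement, the obstruction to gluing two logarithms along the two
  ends of an arc is one integer, and for three points one integer combination of the two
  obstructions vanishes.

  Lower bound for partitions. Take concentric squares, each joined to the next by four spokes.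
  Away from the innermost and the outermost square every vertex has degree 4, so that each part of
  a degree 3 partition reaches only one square deeper from either side. About \<open>n / 8\<close> parts
  are necessary, which is more than \<open>sqrt n / 2\<close>.
\<close>

section \<open>Continuous logarithms on plane compacta\<close>

text \<open>Two distinct logarithms of the same number are at distance at least \<open>2 pi\<close>.\<close>

lemma continuous_constant_exp:
  fixes q :: "'b::topological_space \<Rightarrow> complex"
  assumes "connected S" "continuous_on S q" "\<And>x. x \<in> S \<Longrightarrow> exp (q x) = c"
  shows "q constant_on S"
proof (rule continuous_discrete_range_constant [OF assms(1,2)])
  fix x assume x: "x \<in> S"
  have "2*pi \<le> norm (q y - q x)" if y: "y \<in> S" "q y \<noteq> q x" for y
  proof -
    have "exp (q y) = exp (q x)" using assms(3) x y(1) by simp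
    then have "2*pi \<le> \<bar>Im (q y) - Im (q x)\<bar>"
      using exp_complex_eqI y(2) by (meson not_less)
    also have "\<dots> \<le> norm (q y - q x)" using abs_Im_le_cmod [of "q y - q x"] by simp
    finally show ?thesis .
  qed
  then show "\<exists>e>0. \<forall>y. y \<in> S \<and> q y \<noteq> q x \<longrightarrow> e \<le> norm (q y - q x)"
    by (intro exI[of _ "2*pi"]) auto
qed

lemma log_of_power_on_circle:
  fixes h :: "complex \<Rightarrow> complex"
  assumes "continuous_on UNIV h" "R > 0"
    and "\<And>t. exp (h (a + of_real R * cis t)) = (of_real R * cis t) powi k"
  shows "k = 0"
proof -
  define q where "q t = h (a + of_real R * cis t) - \<i> * of_real (of_int k * t)" for t
  have "continuous_on UNIV (\<lambda>t. h (a + of_real R * cis t))"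
    by (rule continuous_on_compose2[OF assms(1)]) (auto intro!: continuous_intros)
  then have "continuous_on UNIV q"
    unfolding q_def by (intro continuous_intros) 
  moreover have "exp (q t) = of_real R powi k" for t
  proof -
    have "exp (\<i> * of_real (of_int k * t)) = cis t powi k"
      by (simp add: cis_conv_exp exp_power_int mult_ac)
    then show ?thesis
      by (simp add: q_def exp_diff assms(3) power_int_mult_distrib)
  qed
  ultimately have "q constant_on UNIV"
    by (intro continuous_constant_exp) auto
  then have "q (2*pi) = q 0" by (metis UNIV_I constant_on_def)
  then show "k = 0" by (simp add: q_def)
qed

text \<open>On the frontier of \<open>U\<close> the function \<open>(z - a) powi k\<close> equals \<open>exp L / \<phi>\<close>, and \<open>L\<close> extends
  continuously by Tietze's theorem. Replacing \<open>(z - a) powi k\<close> by this quotient inside \<open>U\<close> removes the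
  singularity at \<open>a\<close>, so a zero-free function on the whole plane agrees with
  \<open>(z - a) powi k\<close> on a large circle. Such a function has a logarithm, which forces \<open>k = 0\<close>.\<close>

lemma log_exponent_zero:
  fixes a :: complex
  assumes "compact X" "U \<in> components (- X)" "bounded U" "a \<in> U"
    and L: "continuous_on X L"
    and \<phi>: "continuous_on (closure U) \<phi>" "\<And>z. z \<in> closure U \<Longrightarrow> \<phi> z \<noteq> 0"
    and eq: "\<And>z. z \<in> X \<Longrightarrow> exp (L z) = (z - a) powi k * \<phi> z"
  shows "k = 0"
proof -
  have clX: "closed X" using assms(1) by (rule compact_imp_closed)
  have fr: "frontier U \<subseteq> X" by (rule frontier_of_components_closed_complement[OF clX assms(2)])
  have opU: "open U" using assms(2) clX open_Compl open_components by blast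
  obtain M where M: "continuous_on UNIV M" "\<And>z. z \<in> X \<Longrightarrow> M z = L z"
    using Tietze_unbounded[OF L, of UNIV] clX by auto
  define \<psi> where "\<psi> z = (if z \<in> - U then (z - a) powi k else exp (M z) / \<phi> z)" for z
  have "continuous_on (-U \<union> closure U) \<psi>"
    unfolding \<psi>_def
  proof (rule continuous_on_cases)
    show "continuous_on (- U) (\<lambda>z. (z - a) powi k)" 
      using assms(4) by (intro continuous_intros) auto
    show "continuous_on (closure U) (\<lambda>z. exp (M z) / \<phi> z)"
      using \<phi> M(1) by (intro continuous_intros) (auto intro: continuous_on_subset)
    show "\<forall>z. z \<in> - U \<and> z \<notin> - U \<or> z \<in> closure U \<and> z \<in> - U \<longrightarrow> (z - a) powi k = exp (M z) / \<phi> z"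
    proof (intro allI impI)
      fix z assume "z \<in> - U \<and> z \<notin> - U \<or> z \<in> closure U \<and> z \<in> - U"
      then have "z \<in> closure U" "z \<notin> U" by auto
      then have "z \<in> X" using fr opU by (auto simp: frontier_def interior_open)
      then show "(z - a) powi k = exp (M z) / \<phi> z"
        using M(2) eq \<phi>(2) \<open>z \<in> closure U\<close> by simp
    qed
  qed (simp_all add: opU closed_Compl)
  moreover have "-U \<union> closure U = UNIV" using closure_subset by auto
  ultimately have "continuous_on UNIV \<psi>" by simp
  moreover have "\<psi> z \<noteq> 0" for z
    using assms(4) \<phi>(2) closure_subset by (auto simp: \<psi>_def)
  ultimately obtain h where h: "continuous_on UNIV h" "\<And>z. \<psi> z = exp (h z)"
    by (metis continuous_logarithm_on_contractible contractible_UNIV UNIV_I)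
  obtain R where R: "R > 0" "U \<subseteq> ball a R"
    using assms(3) bounded_subset_ballD by blast
  show ?thesis
  proof (rule log_of_power_on_circle[OF h(1) R(1)])
    fix t
    have "a + of_real R * cis t \<notin> ball a R"
      using R(1) by (simp add: dist_norm norm_mult)
    then have "a + of_real R * cis t \<in> - U" using R(2) by auto
    then show "exp (h (a + of_real R * cis t)) = (of_real R * cis t) powi k"
      by (simp add: \<psi>_def flip: h(2))
  qed
qed

text \<open>Moving \<open>a\<close> to \<open>b\<close> off \<open>X\<close> is a homotopy between the two directions of sight
  \<open>(z - a) / |z - a|\<close> and \<open>(z - b) / |z - b|\<close>, so their quotient is inessential.\<close>

lemma connected_component_imp_log:
  fixes a b :: complex
  assumes "compact X" "connected_component (- X) a b"
  obtains g where "continuous_on X g" "\<And>z. z \<in> X \<Longrightarrow> (z - a) / (z - b) = exp (g z)"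
proof -
  have ab: "a \<notin> X" "b \<notin> X" using assms(2) connected_component_in by force+
  have "homotopic_with_canon (\<lambda>x. True) X (sphere 0 1)
     (\<lambda>x. (x - a) /\<^sub>R norm (x - a)) (\<lambda>x. (x - b) /\<^sub>R norm (x - b))"
    using Borsuk_maps_homotopic_in_connected_component_eq[OF assms(1) ab] assms(2) by simp
  from homotopic_circlemaps_divide[THEN iffD1, OF this]
  obtain c where "homotopic_with_canon (\<lambda>x. True) X (sphere 0 1)
     (\<lambda>x. ((x - a) /\<^sub>R norm (x - a)) / ((x - b) /\<^sub>R norm (x - b))) (\<lambda>x. c)"
    by (elim conjE exE) (rule that)
  then have "homotopic_with_canon (\<lambda>x. True) X (-{0})
     (\<lambda>x. ((x - a) /\<^sub>R norm (x - a)) / ((x - b) /\<^sub>R norm (x - b))) (\<lambda>x. c)"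
    by (rule homotopic_with_subset_right) auto
  then have "\<exists>c. homotopic_with_canon (\<lambda>x. True) X (-{0})
     (\<lambda>x. ((x - a) /\<^sub>R norm (x - a)) / ((x - b) /\<^sub>R norm (x - b))) (\<lambda>x. c)"
    by (rule exI)
  from inessential_eq_continuous_logarithm[THEN iffD1, OF this]
  obtain g where g: "continuous_on X g"
    "\<forall>x\<in>X. ((x - a) /\<^sub>R norm (x - a)) / ((x - b) /\<^sub>R norm (x - b)) = exp (g x)"
    by (elim conjE exE) (rule that)
  show thesis
  proof
    show "continuous_on X (\<lambda>z. g z + of_real (ln (norm (z - a) / norm (z - b))))"
      using ab g(1) by (intro continuous_intros) auto
    fix z assume z: "z \<in> X"
    then have "norm (z - a) > 0" "norm (z - b) > 0" using ab by auto
    moreover have "((z - a) /\<^sub>R norm (z - a)) / ((z - b) /\<^sub>R norm (z - b)) = 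
      (z - a) / (z - b) * (of_real (norm (z - b)) / of_real (norm (z - a)))"
      by (simp add: scaleR_conv_of_real field_simps)
    ultimately have "exp (g z) = (z - a) / (z - b) * (of_real (norm (z - b)) / of_real (norm (z - a)))"
      "exp (of_real (ln (norm (z - a) / norm (z - b)))) = (of_real (norm (z - a)) / of_real (norm (z - b)) :: complex)"
      using g(2) z by (simp_all add: exp_of_real)
    then show "(z - a) / (z - b) = exp (g z + of_real (ln (norm (z - a) / norm (z - b))))"
      using \<open>norm (z - a) > 0\<close> \<open>norm (z - b) > 0\<close> by (simp add: exp_add)
  qed
qed

text \<open>The multiplicative independence of the functions \<open>z - a\<close>, up to logarithms, for points \<open>a\<close> of
  different components: only one component is unbounded, so the exponents of the bounded ones
  vanish, and the exponent of the remaining one vanishes because of the sum.\<close>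

lemma log_exponents_zero:
  fixes a1 a2 a3 :: complex
  assumes X: "compact X" "a1 \<notin> X" "a2 \<notin> X" "a3 \<notin> X"
    and sep: "\<not> connected_component (- X) a1 a2" "\<not> connected_component (- X) a1 a3"
      "\<not> connected_component (- X) a2 a3"
    and L: "continuous_on X L"
    and eq: "\<And>z. z \<in> X \<Longrightarrow> exp (L z) = (z - a1) powi c1 * (z - a2) powi c2 * (z - a3) powi c3"
    and sum: "c1 + c2 + c3 = 0"
  shows "c1 = 0 \<and> c2 = 0 \<and> c3 = 0"
proof -
  have clX: "closed X" using X(1) by (rule compact_imp_closed)
  have *: "k = 0"
    if bdd: "bounded (connected_component_set (- X) a)" and a: "a \<notin> X" "b \<notin> X" "c \<notin> X"
      and nc: "\<not> connected_component (- X) a b" "\<not> connected_component (- X) a c"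
      and e: "\<And>z. z \<in> X \<Longrightarrow> exp (L z) = (z - a) powi k * ((z - b) powi l * (z - c) powi m)"
    for a b c k l m
  proof (rule log_exponent_zero[OF X(1) _ bdd _ L _ _ e])
    let ?U = "connected_component_set (- X) a"
    show U: "?U \<in> components (- X)" using a by (simp add: componentsI)
    show "a \<in> ?U" using a by simp
    have "closure ?U \<subseteq> ?U \<union> X"
      using frontier_of_components_closed_complement[OF clX U] closure_Un_frontier by blast
    then have "b \<notin> closure ?U" "c \<notin> closure ?U" using nc a by auto
    then have bc: "z - b \<noteq> 0 \<and> z - c \<noteq> 0" if "z \<in> closure ?U" for z
      using that by auto
    show "continuous_on (closure ?U) (\<lambda>z. (z - b) powi l * (z - c) powi m)"
      using bc by (intro continuous_intros) auto
    show "(z - b) powi l * (z - c) powi m \<noteq> 0" if "z \<in> closure ?U" for z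
      using bc[OF that] by simp
  qed
  have ub: "connected_component (- X) a b" 
    if "\<not> bounded (connected_component_set (- X) a)" "\<not> bounded (connected_component_set (- X) b)" 
       "a \<notin> X" "b \<notin> X" for a b
  proof -
    have "connected_component_set (- X) a = connected_component_set (- X) b"
      using that X(1) compact_imp_bounded
      by (intro cobounded_unique_unbounded_component[of "- X"]) (auto simp: componentsI)
    then show ?thesis using that(4) by (metis ComplI connected_component_refl_eq mem_Collect_eq)
  qed
  have sep': "\<not> connected_component (- X) a2 a1" "\<not> connected_component (- X) a3 a1"
      "\<not> connected_component (- X) a3 a2"
    using sep connected_component_sym by metis+
  have "c1 = 0" if "bounded (connected_component_set (- X) a1)"
    using *[OF that X(2,3,4) sep(1,2), of c1 c2 c3] by (simp add: eq mult_ac)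
  moreover have "c2 = 0" if "bounded (connected_component_set (- X) a2)"
    using *[OF that X(3,2,4) sep'(1) sep(3), of c2 c1 c3] by (simp add: eq mult_ac)
  moreover have "c3 = 0" if "bounded (connected_component_set (- X) a3)"
    using *[OF that X(4,2,3) sep'(2,3), of c3 c1 c2] by (simp add: eq mult_ac)
  ultimately have "c1 = 0 \<and> c2 = 0 \<or> c1 = 0 \<and> c3 = 0 \<or> c2 = 0 \<and> c3 = 0"
    using ub[of a1 a2] ub[of a1 a3] ub[of a2 a3] X sep by blast
  then show ?thesis using sum by auto
qed

lemma exp_combination_of_logs:
  fixes u v w p q :: complex
  assumes "w \<noteq> 0" "u / w = exp p" "v / w = exp q"
  shows "exp (of_int c1 * p + of_int c2 * q) = u powi c1 * v powi c2 * w powi (- c1 - c2)"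
proof -
  have "exp (of_int c1 * p + of_int c2 * q) = (u / w) powi c1 * (v / w) powi c2"
    by (simp only: exp_add exp_power_int assms(2,3))
  also have "\<dots> = u powi c1 * v powi c2 * (inverse (w powi c1) * inverse (w powi c2))"
    unfolding power_int_divide_distrib by (simp add: divide_inverse mult_ac)
  also have "inverse (w powi c1) * inverse (w powi c2) = w powi (- c1 - c2)"
    using assms(1) power_int_add[of w "- c1" "- c2"] by (simp add: power_int_minus)
  finally show ?thesis .
qed

text \<open>Let \<open>u1\<close> and \<open>u2\<close> be the quotients \<open>(z - a1) / (z - a3)\<close> and \<open>(z - a2) / (z - a3)\<close>. They have
  logarithms on \<open>X\<close> by the hypothesis and on the arc because an arc does not separate the plane.
  These two logarithms differ at the ends of the arc by multiples of \<open>2 pi \<i>\<close>, and they can be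
  glued to a logarithm on the union if both differences agree. The defects are integers \<open>n1\<close> and
  \<open>n2\<close>, so some nontrivial product \<open>u1 powi c1 * u2 powi c2\<close> has no defect. If the three points
  were in three components, that would contradict the multiplicative independence.\<close>

lemma arc_separates_at_most_two:
  fixes a1 a2 a3 :: complex
  assumes X: "compact X" and \<gamma>: "arc \<gamma>"
    and meet: "path_image \<gamma> \<inter> X = {pathstart \<gamma>, pathfinish \<gamma>}"
    and conn: "connected_component (- X) a1 a3" "connected_component (- X) a2 a3"
    and off: "a1 \<notin> path_image \<gamma>" "a2 \<notin> path_image \<gamma>" "a3 \<notin> path_image \<gamma>"
    and sep: "\<not> connected_component (- (X \<union> path_image \<gamma>)) a1 a2"
      "\<not> connected_component (- (X \<union> path_image \<gamma>)) a1 a3"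
  shows "connected_component (- (X \<union> path_image \<gamma>)) a2 a3"
proof (rule ccontr)
  assume sep3: "\<not> connected_component (- (X \<union> path_image \<gamma>)) a2 a3"
  let ?C = "path_image \<gamma>"
  have cC: "compact ?C" using \<gamma> by (simp add: compact_arc_image)
  have offX: "a1 \<notin> X" "a2 \<notin> X" "a3 \<notin> X" using conn connected_component_in by force+
  have "connected (- ?C)" using connected_arc_complement[OF \<gamma>] by simp
  then have "connected_component (- ?C) a1 a3" "connected_component (- ?C) a2 a3"
    using off unfolding connected_iff_connected_component by blast+
  then obtain h1 h2 where h: "continuous_on ?C h1" "continuous_on ?C h2"
    "\<And>z. z \<in> ?C \<Longrightarrow> (z - a1) / (z - a3) = exp (h1 z)"
    "\<And>z. z \<in> ?C \<Longrightarrow> (z - a2) / (z - a3) = exp (h2 z)"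
    using connected_component_imp_log[OF cC] by metis
  obtain g1 g2 where g: "continuous_on X g1" "continuous_on X g2"
    "\<And>z. z \<in> X \<Longrightarrow> (z - a1) / (z - a3) = exp (g1 z)"
    "\<And>z. z \<in> X \<Longrightarrow> (z - a2) / (z - a3) = exp (g2 z)"
    using connected_component_imp_log[OF X] conn by metis
  define a b where "a = pathstart \<gamma>" and "b = pathfinish \<gamma>"
  have ab: "a \<in> ?C" "b \<in> ?C" "a \<in> X" "b \<in> X" using meet by (auto simp: a_def b_def)
  then have nz: "a - a1 \<noteq> 0" "a - a2 \<noteq> 0" "a - a3 \<noteq> 0" "b - a1 \<noteq> 0" "b - a2 \<noteq> 0" "b - a3 \<noteq> 0"
    using off by auto
  have "exp ((g1 b - h1 b) - (g1 a - h1 a)) = 1" "exp ((g2 b - h2 b) - (g2 a - h2 a)) = 1"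
    using ab nz g(3,4)[symmetric] h(3,4)[symmetric] by (simp_all add: exp_diff)
  then obtain n1 n2 :: int where n: "(g1 b - h1 b) - (g1 a - h1 a) = of_int n1 * (2 * pi * \<i>)"
     "(g2 b - h2 b) - (g2 a - h2 a) = of_int n2 * (2 * pi * \<i>)"
    unfolding exp_eq_1 by (auto simp: complex_eq_iff mult_ac)
  \<comment> \<open>Exponents for which the two defects cancel.\<close>
  obtain c1 c2 :: int where c: "c1 * n1 + c2 * n2 = 0" "c1 \<noteq> 0 \<or> c2 \<noteq> 0"
  proof (cases "n1 = 0 \<and> n2 = 0")
    case True then show thesis using that[of 1 0] by simp
  next
    case False then show thesis using that[of n2 "- n1"] by (auto simp: mult.commute)
  qed
  define G where "G z = of_int c1 * g1 z + of_int c2 * g2 z" for z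
  define H where "H z = of_int c1 * h1 z + of_int c2 * h2 z" for z
  define L where "L z = (if z \<in> X then G z else H z + (G a - H a))" for z
  have GH: "G z - H z = of_int c1 * (g1 z - h1 z) + of_int c2 * (g2 z - h2 z)" for z
    by (simp add: G_def H_def algebra_simps)
  have per: "G b - H b = G a - H a" 
  proof -
    have "(G b - H b) - (G a - H a) = of_int c1 * ((g1 b - h1 b) - (g1 a - h1 a)) 
        + of_int c2 * ((g2 b - h2 b) - (g2 a - h2 a))"
      unfolding GH by (simp add: algebra_simps)
    also have "\<dots> = of_int (c1 * n1 + c2 * n2) * (2 * pi * \<i>)"
      using n by (simp add: algebra_simps)
    finally show ?thesis using c(1) by simp
  qed
  have "continuous_on (X \<union> ?C) L"
    unfolding L_def
  proof (rule continuous_on_cases)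
    show "continuous_on X G" "continuous_on ?C (\<lambda>z. H z + (G a - H a))"
      unfolding G_def H_def using g h by (auto intro!: continuous_intros)
    show "\<forall>z. z \<in> X \<and> z \<notin> X \<or> z \<in> ?C \<and> z \<in> X \<longrightarrow> G z = H z + (G a - H a)"
    proof (intro allI impI)
      fix z assume "z \<in> X \<and> z \<notin> X \<or> z \<in> ?C \<and> z \<in> X"
      then have "z \<in> X" "z = a \<or> z = b" using meet by (auto simp: a_def b_def)
      then show "G z = H z + (G a - H a)" using per by (auto simp: algebra_simps)
    qed
  qed (use X cC in \<open>simp_all add: compact_imp_closed\<close>)
  moreover 
  have G: "exp (G z) = (z - a1) powi c1 * (z - a2) powi c2 * (z - a3) powi (-c1-c2)" if "z \<in> X" for z
    unfolding G_def using that offX g(3,4) by (intro exp_combination_of_logs) auto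
  have H: "exp (H z) = (z - a1) powi c1 * (z - a2) powi c2 * (z - a3) powi (-c1-c2)" if "z \<in> ?C" for z
    unfolding H_def using that off h(3,4) by (intro exp_combination_of_logs) auto
  have "exp (L z) = (z - a1) powi c1 * (z - a2) powi c2 * (z - a3) powi (-c1-c2)" if z: "z \<in> X \<union> ?C" for z
  proof -
    have "exp (G a) = exp (H a)" using G[OF ab(3)] H[OF ab(1)] by simp
    then have "exp (G a - H a) = 1" by (simp add: exp_diff)
    then show ?thesis using G H z by (auto simp: L_def exp_add)
  qed
  ultimately have "c1 = 0 \<and> c2 = 0 \<and> -c1-c2 = 0"
    using X cC off offX sep sep3 by (intro log_exponents_zero[of "X \<union> ?C" a1 a2 a3 L]) auto
  then show False using c(2) by simp
qed

section \<open>Arcs and separation of the plane\<close>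

text \<open>The arc and a path in \<open>X\<close> between its ends form a Jordan curve. A point of the arc off \<open>Y\<close> is
  on the frontier of the inside and of the outside, so both meet a small disc that avoids \<open>Y\<close>.
  The larger set \<open>Y\<close> will be the final drawing without this edge, so that the points found here
  remain usable when further edges are inserted.\<close>

lemma arc_closing_loop_splits_face:
  fixes \<gamma> :: "real \<Rightarrow> complex"
  assumes \<gamma>: "arc \<gamma>" and X: "X \<subseteq> Y" "closed Y"
    and meet: "path_image \<gamma> \<inter> Y = {pathstart \<gamma>, pathfinish \<gamma>}"
    and pc: "path_component X (pathstart \<gamma>) (pathfinish \<gamma>)"
  obtains u v where "u \<notin> Y \<union> path_image \<gamma>" "v \<notin> Y \<union> path_image \<gamma>"
    "connected_component (- Y) u v" "\<not> connected_component (- (X \<union> path_image \<gamma>)) u v"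
proof -
  define a b where "a = pathstart \<gamma>" and "b = pathfinish \<gamma>"
  have "a \<noteq> b" using \<gamma> using arc_distinct_ends[of \<gamma>] by (auto simp: a_def b_def)
  have "path_component X b a" using pc by (simp add: a_def b_def path_component_sym)
  then obtain q where q: "path q" "path_image q \<subseteq> X" "pathstart q = b" "pathfinish q = a"
    by (auto simp: path_component_def)
  then obtain \<eta> where \<eta>: "arc \<eta>" "path_image \<eta> \<subseteq> X" "pathstart \<eta> = b" "pathfinish \<eta> = a"
    using path_contains_arc[of q b a] \<open>a \<noteq> b\<close> by (metis order_trans)
  define c where "c = \<gamma> +++ \<eta>"
  have "simple_path c"
    unfolding c_def using \<gamma> \<eta> meet X(1) by (intro simple_path_join_loop) (auto simp: a_def b_def)
  moreover have "pathfinish c = pathstart c" using \<eta> by (simp add: c_def a_def)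
  ultimately have J: "open (inside (path_image c))" "open (outside (path_image c))"
    "inside (path_image c) \<inter> outside (path_image c) = {}"
    "inside (path_image c) \<union> outside (path_image c) = - path_image c"
    "frontier (inside (path_image c)) = path_image c"
    "frontier (outside (path_image c)) = path_image c"
    using Jordan_inside_outside by metis+
  have pc: "path_image c = path_image \<gamma> \<union> path_image \<eta>"
    unfolding c_def using \<eta>(3) by (simp add: path_image_join b_def)
  define z where "z = \<gamma> (1/2)"
  have z: "z \<in> path_image \<gamma>" by (auto simp: z_def path_image_def)
  have inj: "inj_on \<gamma> {0..1}" using \<gamma> by (simp add: arc_def)
  have "z \<noteq> pathstart \<gamma>" "z \<noteq> pathfinish \<gamma>" 
    using inj_onD[OF inj, of "1/2" 0] inj_onD[OF inj, of "1/2" 1]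
    by (auto simp: z_def pathstart_def pathfinish_def)
  then have "z \<in> - Y" using z meet by auto
  then obtain r where r: "r > 0" "ball z r \<subseteq> - Y"
    using X(2) open_contains_ball by (metis open_Compl)
  have "z \<in> closure (inside (path_image c))" "z \<in> closure (outside (path_image c))"
    using J(5,6) z pc by (auto simp: frontier_def)
  then have "\<exists>u\<in>inside (path_image c). dist u z < r" "\<exists>v\<in>outside (path_image c). dist v z < r"
    using r(1) unfolding closure_approachable by blast+
  then obtain u v where uv: "u \<in> inside (path_image c)" "u \<in> ball z r" 
    "v \<in> outside (path_image c)" "v \<in> ball z r"
    by (auto simp: dist_commute)
  have "u \<notin> path_image c" "v \<notin> path_image c" using uv(1,3) J(4) by blast+
  show thesis
  proof
    show "u \<notin> Y \<union> path_image \<gamma>" "v \<notin> Y \<union> path_image \<gamma>" 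
      using uv(2,4) r(2) \<open>u \<notin> path_image c\<close> \<open>v \<notin> path_image c\<close> unfolding pc by blast+
    show "connected_component (- Y) u v"
      using uv r(2) connected_ball[of z r] unfolding connected_component_def by blast
    show "\<not> connected_component (- (X \<union> path_image \<gamma>)) u v"
    proof
      assume "connected_component (- (X \<union> path_image \<gamma>)) u v"
      then obtain T where T: "connected T" "T \<subseteq> - (X \<union> path_image \<gamma>)" "u \<in> T" "v \<in> T"
        by (auto simp: connected_component_def)
      then have "T \<subseteq> inside (path_image c) \<union> outside (path_image c)" using J(4) pc \<eta>(2) by auto
      then show False using connectedD[OF T(1) J(1,2)] J(3) T(3,4) uv(1,3) by blast
    qed
  qed
qed

text \<open>By Janiszewski, since neither set separates the plane and their intersection is connected.\<close>

lemma connected_complement_Un_arc: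
  fixes \<gamma> :: "real \<Rightarrow> complex"
  assumes "compact Z" "connected (- Z)" "arc \<gamma>" "Z \<inter> path_image \<gamma> \<subseteq> {x}"
  shows "connected (- (Z \<union> path_image \<gamma>))"
proof (rule Janiszewski_connected)
  have "Z \<inter> path_image \<gamma> = {} \<or> Z \<inter> path_image \<gamma> = {x}" using assms(4) by auto
  then show "connected (Z \<inter> path_image \<gamma>)" by auto
  show "connected (- path_image \<gamma>)" by (rule connected_arc_complement[OF assms(3)]) simp
qed (use assms in \<open>auto simp: closed_arc_image\<close>)

text \<open>If each of three edges had both of its ends on the other two, they would form a triangle. So the
  edges can be drawn in an order in which each new arc meets the previous ones in at most a point.\<close>

lemma three_edges_forest:
  fixes e1 e2 e3 :: "'a set"
  assumes "card e1 = 2" "card e2 = 2" "card e3 = 2" "e1 \<noteq> e2" "e1 \<noteq> e3" "e2 \<noteq> e3"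
    and tri: "\<nexists>x y z. {x, y} \<in> {e1, e2, e3} \<and> {y, z} \<in> {e1, e2, e3} \<and> {x, z} \<in> {e1, e2, e3}"
  shows "\<exists>x. (e1 \<union> e2) \<inter> e3 \<subseteq> {x} \<or> (e1 \<union> e3) \<inter> e2 \<subseteq> {x} \<or> (e2 \<union> e3) \<inter> e1 \<subseteq> {x}"
proof (rule ccontr)
  assume no: "\<not> ?thesis"
  obtain x y where e3: "e3 = {x, y}" "x \<noteq> y" using assms(3) by (auto simp: card_2_iff)
  have "x \<in> e1 \<union> e2" "y \<in> e1 \<union> e2" using no e3 by blast+
  moreover have "\<not> {x, y} \<subseteq> e1" "\<not> {x, y} \<subseteq> e2"
    using assms e3 by (metis card_subset_eq card_ge_0_finite zero_less_numeral)+
  ultimately obtain e f where ef: "{e, f} = {e1, e2}" "x \<in> e" "y \<in> f" "y \<notin> e" "x \<notin> f" by blast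
  then have "card e = 2" "card f = 2" using assms by (auto simp: doubleton_eq_iff)
  then obtain u v where uv: "e = {x, u}" "f = {y, v}" using ef(2,3) by (auto simp: card_2_iff)
  have "(f \<union> e3) \<inter> e = {x} \<union> ({u} \<inter> {v})" using uv e3 ef by auto
  moreover have "\<not> (f \<union> e3) \<inter> e \<subseteq> {x}" using no ef(1) by (auto simp: doubleton_eq_iff)
  ultimately have "u = v" by blast
  moreover have "e \<in> {e1, e2, e3}" "f \<in> {e1, e2, e3}" using ef(1) by (auto simp: doubleton_eq_iff)
  ultimately have "{u, x} \<in> {e1, e2, e3}" "{x, y} \<in> {e1, e2, e3}" "{u, y} \<in> {e1, e2, e3}" 
    using uv e3(1) by (simp_all add: insert_commute)
  then show False using tri by blast
qed

section \<open>The edge bound for plane drawings\<close>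

locale plane_drawing =
  fixes V :: "'a set" and E :: "'a set set" and p :: "'a \<Rightarrow> complex"
    and \<gamma> :: "'a set \<Rightarrow> real \<Rightarrow> complex"
  assumes finV: "finite V"
    and edge: "e \<in> E \<Longrightarrow> e \<subseteq> V" "e \<in> E \<Longrightarrow> card e = 2"
    and inj_p: "inj_on p V"
    and arc: "e \<in> E \<Longrightarrow> arc (\<gamma> e)"
    and ends: "e \<in> E \<Longrightarrow> {pathstart (\<gamma> e), pathfinish (\<gamma> e)} = p ` e"
    and off_verts: "e \<in> E \<Longrightarrow> (path_image (\<gamma> e) - p ` e) \<inter> p ` V = {}"
    and off_edges: "e \<in> E \<Longrightarrow> e' \<in> E \<Longrightarrow> e' \<noteq> e \<Longrightarrow> (path_image (\<gamma> e) - p ` e) \<inter> path_image (\<gamma> e') = {}"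
begin

definition drawing :: "'a set set \<Rightarrow> complex set" where
  "drawing A = p ` V \<union> (\<Union>e\<in>A. path_image (\<gamma> e))"

lemma finE: "finite E"
  by (rule finite_subset[of E "Pow V"]) (use finV edge(1) in auto)

lemma compact_drawing:
  assumes "A \<subseteq> E"
  shows "compact (drawing A)"
proof -
  have "finite A" using assms finE finite_subset by blast
  then have "compact (\<Union>e\<in>A. path_image (\<gamma> e))"
    using assms arc by (intro compact_UN) (auto simp: compact_arc_image)
  then show ?thesis unfolding drawing_def using finV by (simp add: compact_Un finite_imp_compact)
qed

lemma drawing_mono: "A \<subseteq> B \<Longrightarrow> drawing A \<subseteq> drawing B"
  unfolding drawing_def by auto

lemma drawing_insert: "drawing (insert e A) = drawing A \<union> path_image (\<gamma> e)"
  unfolding drawing_def by auto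

lemma ends_in_drawing: "e \<in> E \<Longrightarrow> p ` e \<subseteq> drawing A"
  unfolding drawing_def using edge(1) by auto

lemma edge_meets_drawing:
  assumes "e \<in> E" "A \<subseteq> E" "e \<notin> A"
  shows "path_image (\<gamma> e) \<inter> drawing A = {pathstart (\<gamma> e), pathfinish (\<gamma> e)}"
proof -
  have "(path_image (\<gamma> e) - p ` e) \<inter> drawing A = {}"
    using off_verts off_edges assms unfolding drawing_def by blast
  moreover have "p ` e \<subseteq> path_image (\<gamma> e)"
    using ends[OF assms(1)] by (metis empty_subsetI insert_subset pathfinish_in_path_image pathstart_in_path_image)
  ultimately have "path_image (\<gamma> e) \<inter> drawing A = p ` e"
    using ends_in_drawing[OF assms(1), of A] by blast
  then show ?thesis using ends[OF assms(1)] by simp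
qed

lemma edges_meet:
  assumes "e \<in> E" "f \<in> E" "e \<noteq> f"
  shows "path_image (\<gamma> e) \<inter> path_image (\<gamma> f) \<subseteq> p ` (e \<inter> f)"
proof -
  have "path_image (\<gamma> e) \<inter> path_image (\<gamma> f) \<subseteq> p ` e \<inter> p ` f"
    using off_edges[OF assms(1,2)] off_edges[OF assms(2,1)] assms(3) by blast
  also have "\<dots> = p ` (e \<inter> f)"
    using inj_on_image_Int[OF inj_p] edge(1) assms by metis
  finally show ?thesis .
qed

text \<open>A face is represented by one of its points, and \<open>card S\<close> bounds the number of faces from
  below; this way no finiteness of the set of faces is required. The points avoid the complete
  drawing, and not just the part drawn by \<open>A\<close>, in order to survive the insertion of edges.\<close>

definition separated :: "'a set set \<Rightarrow> complex set \<Rightarrow> bool" where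
  "separated A S \<longleftrightarrow> finite S \<and> S \<inter> drawing E = {} \<and>
     (\<forall>u\<in>S. \<forall>v\<in>S. u \<noteq> v \<longrightarrow> \<not> connected_component (- drawing A) u v)"

lemma separated_mono:
  assumes "separated A S" "A \<subseteq> B"
  shows "separated B S"
proof -
  have "- drawing B \<subseteq> - drawing A" using drawing_mono[OF assms(2)] by auto
  then show ?thesis using assms(1) connected_component_of_subset unfolding separated_def by blast
qed

text \<open>The new edge splits a face in two. At most one old representative belongs to this face, and it
  gives way to one point from each of the two pieces.\<close>

lemma separated_insert_loop:
  assumes e: "e \<in> E" "A \<subseteq> E" "e \<notin> A"
    and pc: "path_component (drawing A) (pathstart (\<gamma> e)) (pathfinish (\<gamma> e))"
    and S: "separated A S"
  obtains S' where "separated (insert e A) S'" "card S' \<ge> card S + 1"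
proof -
  let ?Y = "drawing (E - {e})"
  have "closed ?Y" using compact_drawing by (simp add: compact_imp_closed)
  moreover have AY: "drawing A \<subseteq> ?Y" using e by (intro drawing_mono) auto
  moreover have "path_image (\<gamma> e) \<inter> ?Y = {pathstart (\<gamma> e), pathfinish (\<gamma> e)}"
    using e by (intro edge_meets_drawing) auto
  ultimately obtain u v where uv: "u \<notin> ?Y \<union> path_image (\<gamma> e)" "v \<notin> ?Y \<union> path_image (\<gamma> e)"
    "connected_component (- ?Y) u v" "\<not> connected_component (- drawing (insert e A)) u v"
    using arc_closing_loop_splits_face[OF arc[OF e(1)] _ _ _ pc] unfolding drawing_insert by metis
  have YE: "?Y \<union> path_image (\<gamma> e) = drawing E"
    using drawing_insert[of e "E - {e}"] e(1) by (simp add: insert_absorb)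
  have cuv: "connected_component (- drawing A) u v"
    using uv(3) AY connected_component_of_subset by (metis Compl_subset_Compl_iff)
  have ins: "connected_component (- drawing (insert e A)) x y \<Longrightarrow> connected_component (- drawing A) x y" for x y
    using connected_component_of_subset drawing_mono[of A "insert e A"] by (metis Compl_subset_Compl_iff subset_insertI)
  define D where "D = {s \<in> S. connected_component (- drawing A) u s}"
  define S' where "S' = insert u (insert v (S - D))"
  have "u \<noteq> v"
  proof
    assume "u = v"
    have "u \<notin> drawing (insert e A)" using uv(1) YE drawing_mono[of "insert e A" E] e by auto
    then show False using uv(4) \<open>u = v\<close> by simp
  qed
  have finS: "finite S" using S by (simp add: separated_def)
  have "s = t" if "s \<in> D" "t \<in> D" for s t
  proof -
    have "connected_component (- drawing A) s t" 
      using that unfolding D_def by (metis (no_types, lifting) connected_component_sym connected_component_trans mem_Collect_eq)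
    then show ?thesis using that S unfolding D_def separated_def by auto
  qed
  then have "card D \<le> 1" using card_le_Suc0_iff_eq[of D] finS by (auto simp: D_def)
  moreover have nin: "u \<notin> S - D" "v \<notin> S - D" 
    using cuv connected_component_in[OF cuv] by (auto simp: D_def)
  ultimately have "card S' \<ge> card S + 1"
    using \<open>u \<noteq> v\<close> finS card_Diff_subset[of D S] by (auto simp: S'_def D_def)
  moreover have "separated (insert e A) S'"
    unfolding separated_def
  proof (intro conjI ballI impI)
    show "finite S'" using finS by (simp add: S'_def)
    show "S' \<inter> drawing E = {}" using S uv(1,2) unfolding YE S'_def separated_def by auto
    fix x y assume xy: "x \<in> S'" "y \<in> S'" "x \<noteq> y"
    have no: "\<not> connected_component (- drawing A) w s" if "s \<in> S - D" "w \<in> {u, v}" for s w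
    proof
      assume "connected_component (- drawing A) w s"
      then have "connected_component (- drawing A) u s" using cuv that(2) connected_component_trans by fastforce
      then show False using that(1) by (auto simp: D_def)
    qed
    show "\<not> connected_component (- drawing (insert e A)) x y"
    proof
      assume c: "connected_component (- drawing (insert e A)) x y"
      note c1 = ins[OF c] 
      note c2 = connected_component_sym[OF c1]
      consider "x \<in> {u,v}" "y \<in> {u,v}" | "x \<in> {u,v}" "y \<in> S - D" | "x \<in> S - D" "y \<in> {u,v}" 
        | "x \<in> S" "y \<in> S" using xy by (auto simp: S'_def)
      then show False
      proof cases
        case 1 then show False using c connected_component_sym[OF c] uv(4) xy(3) by auto
      next
        case 2 then show False using no c1 by auto
      next
        case 3 then show False using no c2 by auto
      next
        case 4 then show False using S c1 xy(3) by (auto simp: separated_def)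
      qed
    qed
  qed
  ultimately show thesis using that by blast
qed

text \<open>The labelling \<open>c\<close> plays the role of the connected components of the graph: vertices with equal
  labels are joined in the drawing. An edge between equal labels adds a face; an edge between
  different labels merges two of them. Starting from \<open>|V|\<close> labels and one face, the quantity
  (faces) - (labels) - (edges) never decreases.\<close>

lemma euler_lower_bound:
  assumes "A \<subseteq> E"
  shows "\<exists>(c :: 'a \<Rightarrow> 'a) S. (\<forall>u\<in>V. \<forall>v\<in>V. c u = c v \<longrightarrow> path_component (drawing A) (p u) (p v)) \<and>
    separated A S \<and> card A + card (c ` V) + 1 \<le> card S + card V"
  using finite_subset[OF assms finE] assms
proof (induction A rule: finite_induct)
  case empty
  have "drawing E \<noteq> UNIV" using compact_drawing[of E] not_compact_UNIV by auto
  then obtain z where z: "z \<notin> drawing E" by auto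
  have "p v \<in> drawing {}" if "v \<in> V" for v using that by (auto simp: drawing_def)
  then show ?case using z finV
    by (intro exI[of _ id] exI[of _ "{z}"]) (auto simp: separated_def path_component_refl)
next
  case (insert e A)
  then have eA: "e \<in> E" "A \<subseteq> E" by auto
  from insert.IH[OF eA(2)] obtain c :: "'a \<Rightarrow> 'a" and S 
    where cV: "\<forall>u\<in>V. \<forall>v\<in>V. c u = c v \<longrightarrow> path_component (drawing A) (p u) (p v)"
    and S: "separated A S" and le: "card A + card (c ` V) + 1 \<le> card S + card V"
    by (elim exE conjE) (rule that)
  have c: "path_component (drawing A) (p u) (p v)" if "u \<in> V" "v \<in> V" "c u = c v" for u v
    using cV that by simp
  have "pathstart (\<gamma> e) \<in> p ` e" "pathfinish (\<gamma> e) \<in> p ` e"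
    unfolding ends[OF eA(1), symmetric] by simp_all
  then obtain a b where "p a = pathstart (\<gamma> e)" "p b = pathfinish (\<gamma> e)" "a \<in> e" "b \<in> e"
    by (metis imageE)
  then have ab: "p a = pathstart (\<gamma> e)" "p b = pathfinish (\<gamma> e)" "a \<in> V" "b \<in> V" 
    using edge(1)[OF eA(1)] by auto
  have mono: "path_component (drawing A) x y \<Longrightarrow> path_component (drawing (insert e A)) x y" for x y
    using path_component_of_subset drawing_mono[of A "insert e A"] by blast
  show ?case
  proof (cases "c a = c b")
    case True
    then have "path_component (drawing A) (pathstart (\<gamma> e)) (pathfinish (\<gamma> e))" 
      using c[OF ab(3,4)] ab(1,2) by simp
    then obtain S' where "separated (insert e A) S'" "card S' \<ge> card S + 1"
      using separated_insert_loop[OF eA insert.hyps(2) _ S] by metis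
    then show ?thesis using le insert.hyps c mono by (intro exI[of _ c] exI[of _ S']) auto
  next
    case False
    define c' where "c' v = (if c v = c a then c b else c v)" for v
    have "c' ` V \<subseteq> c ` V - {c a}" using False ab(4) by (auto simp: c'_def)
    then have "card (c' ` V) \<le> card (c ` V - {c a})" using finV by (intro card_mono) auto
    moreover have "card (c ` V) > 0" using finV ab(3) by (auto simp: card_gt_0_iff)
    ultimately have cd: "card (c' ` V) + 1 \<le> card (c ` V)" using ab(3) finV by simp
    have "path_component (path_image (\<gamma> e)) (p a) (p b)"
      using arc[OF eA(1)] ab(1,2) by (metis arc_imp_path path_component_def subset_refl)
    then have ab': "path_component (drawing (insert e A)) (p a) (p b)"
      using path_component_of_subset drawing_insert by blast
    have "path_component (drawing (insert e A)) (p u) (p v)" if uv: "u \<in> V" "v \<in> V" "c' u = c' v" for u v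
    proof -
      have C: "path_component (drawing (insert e A)) (p x) (p y)" if "x \<in> V" "y \<in> V" "c x = c y" for x y
        using c[OF that] mono by blast
      consider "c u = c v" | "c u = c a" "c v = c b" | "c u = c b" "c v = c a"
        using uv(3) by (auto simp: c'_def split: if_splits)
      then show ?thesis
      proof cases
        case 1 then show ?thesis using C uv by blast
      next
        case 2 then show ?thesis using C[of u a] C[of b v] ab' uv ab by (metis path_component_trans)
      next
        case 3 then show ?thesis using C[of u b] C[of a v] ab' uv ab by (metis path_component_trans path_component_sym)
      qed
    qed
    moreover have "separated (insert e A) S" using separated_mono[OF S] by blast
    ultimately show ?thesis using le cd insert.hyps by (intro exI[of _ c'] exI[of _ S]) auto
  qed
qed

definition touched :: "complex \<Rightarrow> 'a set set" where
  "touched s = {e \<in> E. frontier (connected_component_set (- drawing E) s) \<inter> (path_image (\<gamma> e) - p ` e) \<noteq> {}}"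

text \<open>A forest is drawn by adding one arc at a time to a set that the arc meets in at most one point.\<close>

lemma few_edges_dont_separate:
  assumes T: "T \<subseteq> E" "card T \<le> 3"
    and tri: "\<nexists>x y z. {x, y} \<in> E \<and> {y, z} \<in> E \<and> {x, z} \<in> E"
  shows "connected (- (\<Union>e\<in>T. path_image (\<gamma> e)))"
proof -
  have single: "connected (- path_image (\<gamma> e))" if "e \<in> E" for e
    using connected_arc_complement[OF arc[OF that]] by simp
  have two: "connected (- (path_image (\<gamma> e) \<union> path_image (\<gamma> f)))" if ef: "e \<in> E" "f \<in> E" "e \<noteq> f" for e f
  proof -
    have "card (e \<inter> f) \<noteq> 2" using edge(2) ef card_subset_eq[of e "e \<inter> f"] card_subset_eq[of f "e \<inter> f"]
      by (metis card_ge_0_finite inf_le1 inf_le2 zero_less_numeral)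
    moreover have "card (e \<inter> f) \<le> 2" using edge(2) ef by (metis card_ge_0_finite card_mono inf_le1 zero_less_numeral)
    ultimately have "card (e \<inter> f) \<le> 1" by simp
    moreover have "finite (e \<inter> f)" using edge ef finV by (meson finite_Int finite_subset)
    ultimately obtain x where "e \<inter> f \<subseteq> {x}" by (metis card_le_Suc0_iff_eq One_nat_def insertCI subsetI)
    then have "path_image (\<gamma> e) \<inter> path_image (\<gamma> f) \<subseteq> {p x}" using edges_meet[OF ef] by auto
    then show ?thesis using single ef arc
      by (intro connected_complement_Un_arc) (auto simp: compact_arc_image)
  qed
  have three: "connected (- (path_image (\<gamma> e) \<union> path_image (\<gamma> f) \<union> path_image (\<gamma> g)))" 
    if ef: "e \<in> E" "f \<in> E" "g \<in> E" "e \<noteq> f" "e \<noteq> g" "f \<noteq> g" and x: "(e \<union> f) \<inter> g \<subseteq> {x}" for e f g x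
  proof (rule connected_complement_Un_arc)
    show "(path_image (\<gamma> e) \<union> path_image (\<gamma> f)) \<inter> path_image (\<gamma> g) \<subseteq> {p x}"
      using edges_meet[OF ef(1,3,5)] edges_meet[OF ef(2,3,6)] x by blast
  qed (use two[OF ef(1,2,4)] ef arc in \<open>simp_all add: compact_arc_image compact_Un\<close>)
  consider "card T = 0" | "card T = 1" | "card T = 2" | "card T = 3" using T(2) by linarith
  then show ?thesis
  proof cases
    case 1 
    then have "T = {}" using T(1) finE finite_subset card_0_eq by metis
    then show ?thesis by (simp add: connected_UNIV)
  next
    case 2
    then obtain e where "T = {e}" by (rule card_1_singletonE)
    then show ?thesis using T(1) single by simp
  next
    case 3
    then obtain e f where "T = {e, f}" "e \<noteq> f" unfolding card_2_iff by blast
    then show ?thesis using T(1) two[of e f] by simp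
  next
    case 4
    then obtain e f g where efg: "T = {e, f, g}" "e \<noteq> f" "e \<noteq> g" "f \<noteq> g" unfolding card_3_iff by blast
    then have E: "e \<in> E" "f \<in> E" "g \<in> E" using T(1) by auto
    have "\<nexists>x y z. {x, y} \<in> {e, f, g} \<and> {y, z} \<in> {e, f, g} \<and> {x, z} \<in> {e, f, g}"
    proof (intro notI, elim exE conjE)
      fix x y z assume xyz: "{x, y} \<in> {e, f, g}" "{y, z} \<in> {e, f, g}" "{x, z} \<in> {e, f, g}"
      have sub: "{e, f, g} \<subseteq> E" using E by simp
      show False using tri subsetD[OF sub xyz(1)] subsetD[OF sub xyz(2)] subsetD[OF sub xyz(3)] by blast
    qed
    then obtain x where "(e \<union> f) \<inter> g \<subseteq> {x} \<or> (e \<union> g) \<inter> f \<subseteq> {x} \<or> (f \<union> g) \<inter> e \<subseteq> {x}"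
      using three_edges_forest[of e f g] edge(2) E efg by metis
    then have "connected (- (path_image (\<gamma> e) \<union> path_image (\<gamma> f) \<union> path_image (\<gamma> g))) \<or>
        connected (- (path_image (\<gamma> e) \<union> path_image (\<gamma> g) \<union> path_image (\<gamma> f))) \<or>
        connected (- (path_image (\<gamma> f) \<union> path_image (\<gamma> g) \<union> path_image (\<gamma> e)))"
      using three E efg(2-4) by metis
    moreover have "(\<Union>h\<in>T. path_image (\<gamma> h)) = path_image (\<gamma> e) \<union> path_image (\<gamma> f) \<union> path_image (\<gamma> g)"
      unfolding efg(1) by auto
    ultimately show ?thesis by (simp add: Un_ac)
  qed
qed

text \<open>If three edges sufficed, the face of \<open>s\<close> would be closed in the complement of these edges and
  the vertices. This complement is connected, hence equal to the face, and \<open>t\<close> has no room.\<close>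

lemma face_touches_four_edges:
  assumes S: "separated E S" "s \<in> S" "t \<in> S" "s \<noteq> t"
    and tri: "\<nexists>x y z. {x, y} \<in> E \<and> {y, z} \<in> E \<and> {x, z} \<in> E"
  shows "card (touched s) \<ge> 4"
proof (rule ccontr)
  assume "\<not> ?thesis"
  then have T: "card (touched s) \<le> 3" "touched s \<subseteq> E" by (auto simp: touched_def)
  let ?f = "connected_component_set (- drawing E) s"
  define Z where "Z = (\<Union>e\<in>touched s. path_image (\<gamma> e))"
  have "compact Z" unfolding Z_def using T(2) finE finite_subset arc
    by (intro compact_UN) (auto simp: compact_arc_image)
  then have "open (- Z)" by (simp add: compact_imp_closed open_Compl)
  then have "connected (- Z - p ` V)"
    using few_edges_dont_separate[OF T(2,1) tri] finV
    by (intro connected_open_delete_finite) (simp_all add: Z_def)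
  have ZD: "Z \<union> p ` V \<subseteq> drawing E" using T(2) by (auto simp: Z_def drawing_def)
  have sD: "s \<notin> drawing E" "t \<notin> drawing E" using S by (auto simp: separated_def)
  have "frontier ?f \<subseteq> drawing E"
    using compact_drawing[of E] sD
    by (intro frontier_of_components_closed_complement) (auto simp: compact_imp_closed componentsI)
  moreover have "x \<in> Z \<union> p ` V" if x: "x \<in> frontier ?f" "x \<in> drawing E" for x
  proof (cases "x \<in> p ` V")
    case False
    then obtain e where e: "e \<in> E" "x \<in> path_image (\<gamma> e)" using x(2) by (auto simp: drawing_def)
    moreover have "x \<notin> p ` e" using edge(1)[OF e(1)] False by blast
    ultimately have "e \<in> touched s" using x(1) by (auto simp: touched_def)
    then show ?thesis using e by (auto simp: Z_def)
  qed simp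
  ultimately have "(- Z - p ` V) \<inter> frontier ?f = {}" by blast
  moreover have "s \<in> (- Z - p ` V) \<inter> ?f" using sD ZD by auto
  ultimately have "- Z - p ` V \<subseteq> ?f"
    using connected_Int_frontier[OF \<open>connected (- Z - p ` V)\<close>, of ?f] by blast
  then have "t \<in> ?f" using sD ZD by auto
  then show False using S by (auto simp: separated_def)
qed

text \<open>The faces that touch the edge all belong to the component that contains the interior of the
  edge once the edge is erased, and drawing one arc splits a component into at most two.\<close>

lemma edge_touched_by_two_faces:
  assumes S: "separated E S" and e: "e \<in> E"
  shows "card {s \<in> S. e \<in> touched s} \<le> 2"
proof (rule ccontr)
  assume "\<not> ?thesis"
  then have "3 \<le> card {s \<in> S. e \<in> touched s}" by simp
  then obtain B where "B \<subseteq> {s \<in> S. e \<in> touched s}" "card B = 3"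
    by (metis obtain_subset_with_card_n)
  then obtain s1 s2 s3 where s: "s1 \<in> S" "s2 \<in> S" "s3 \<in> S" "s1 \<noteq> s2" "s1 \<noteq> s3" "s2 \<noteq> s3"
    "e \<in> touched s1" "e \<in> touched s2" "e \<in> touched s3" by (auto simp: card_3_iff)
  let ?X = "drawing (E - {e})"
  have DE: "drawing E = ?X \<union> path_image (\<gamma> e)"
    using drawing_insert[of e "E - {e}"] e by (simp add: insert_absorb)
  have meet: "path_image (\<gamma> e) \<inter> ?X = {pathstart (\<gamma> e), pathfinish (\<gamma> e)}"
    using e by (intro edge_meets_drawing) auto
  let ?I = "path_image (\<gamma> e) - {pathstart (\<gamma> e), pathfinish (\<gamma> e)}"
  have I: "connected ?I" "?I \<subseteq> - ?X"
    using connected_simple_path_endless arc[OF e] arc_imp_simple_path meet by blast+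
  have opX: "open (- ?X)" using compact_drawing[of "E - {e}"] by (simp add: compact_imp_closed open_Compl)
  have touch: "\<exists>z\<in>?I. connected_component (- ?X) s z" if et: "e \<in> touched s" for s
  proof -
    obtain z where z: "z \<in> frontier (connected_component_set (- drawing E) s)" "z \<in> ?I"
      using et ends[OF e] by (auto simp: touched_def)
    then obtain r where r: "r > 0" "ball z r \<subseteq> - ?X" using opX I(2) open_contains_ball by blast
    have "z \<in> closure (connected_component_set (- drawing E) s)" using z(1) by (simp add: frontier_def)
    then obtain w where w: "connected_component (- drawing E) s w" "w \<in> ball z r"
      using r(1) by (auto simp: closure_approachable dist_commute)
    have "connected_component (- ?X) s w" 
      by (rule connected_component_of_subset[OF w(1)]) (auto simp: DE)
    moreover have "connected_component (- ?X) w z"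
      using w(2) r connected_ball[of z r] unfolding connected_component_def by (metis centre_in_ball)
    ultimately show ?thesis using z(2) connected_component_trans by metis
  qed
  have conn: "connected_component (- ?X) s t" if st: "e \<in> touched s" "e \<in> touched t" for s t
  proof -
    obtain y z where yz: "y \<in> ?I" "connected_component (- ?X) s y" "z \<in> ?I" "connected_component (- ?X) t z"
      using touch st by metis
    have "connected_component (- ?X) y z" using I yz unfolding connected_component_def by blast
    then show ?thesis using yz connected_component_trans connected_component_sym by metis
  qed
  have off: "s1 \<notin> path_image (\<gamma> e)" "s2 \<notin> path_image (\<gamma> e)" "s3 \<notin> path_image (\<gamma> e)"
    using S s DE by (auto simp: separated_def)
  have "connected_component (- (?X \<union> path_image (\<gamma> e))) s2 s3"
    by (rule arc_separates_at_most_two[OF _ arc[OF e] meet conn[OF s(7,9)] conn[OF s(8,9)] off])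
       (use S s in \<open>auto simp: separated_def compact_drawing simp flip: DE\<close>)
  then show False using S s unfolding DE[symmetric] separated_def by auto
qed

lemma card_edges_le:
  assumes tri: "\<nexists>x y z. {x, y} \<in> E \<and> {y, z} \<in> E \<and> {x, z} \<in> E"
  shows "card E \<le> 2 * card V"
proof (cases "V = {}")
  case True
  then have "E = {}" using edge by fastforce
  then show ?thesis by simp
next
  case False
  obtain c :: "'a \<Rightarrow> 'a" and S where S: "separated E S" and le: "card E + card (c ` V) + 1 \<le> card S + card V"
    using euler_lower_bound[of E] by blast
  have finS: "finite S" using S by (simp add: separated_def)
  show ?thesis
  proof (cases "card S \<le> 1")
    case True then show ?thesis using le by linarith
  next
    case False
    then have four: "4 \<le> card (touched s)" if "s \<in> S" for s
      using face_touches_four_edges[OF S that _ _ tri] that by (metis card_le_Suc0_iff_eq finS One_nat_def)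
    have touched: "touched s = {e \<in> E. e \<in> touched s}" for s by (auto simp: touched_def)
    have "card S * 4 \<le> (\<Sum>s\<in>S. card (touched s))"
      using four sum_bounded_below[of S 4 "\<lambda>s. card (touched s)"] by simp
    also have "\<dots> = (\<Sum>s\<in>S. card {e \<in> E. e \<in> touched s})" using touched by simp
    also have "\<dots> = (\<Sum>e\<in>E. card {s \<in> S. e \<in> touched s})"
      by (rule sum_multicount_gen[symmetric, OF finE finS]) simp
    also have "\<dots> \<le> card E * 2"
      using edge_touched_by_two_faces[OF S] sum_bounded_above[of E "\<lambda>e. card {s \<in> S. e \<in> touched s}" 2] by simp
    finally show ?thesis using le by linarith
  qed
qed

end

theorem planar_triangle_free_card_edges:
  assumes "finite_simple_graph G" "planar G" "triangle_free G"
  shows "card (edges G) \<le> 2 * card (verts G)"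
proof -
  from assms(2) obtain p :: "'a \<Rightarrow> complex" and \<gamma> where inj: "inj_on p (verts G)"
    and d: "\<forall>e\<in>edges G. arc (\<gamma> e) \<and> {pathstart (\<gamma> e), pathfinish (\<gamma> e)} = p ` e \<and>
           (path_image (\<gamma> e) - p ` e) \<inter> p ` verts G = {} \<and>
           (\<forall>e'\<in>edges G. e' \<noteq> e \<longrightarrow> (path_image (\<gamma> e) - p ` e) \<inter> path_image (\<gamma> e') = {})"
    unfolding planar_def by (elim exE conjE) (rule that)
  have fsg: "finite (verts G)" "\<forall>e\<in>edges G. e \<subseteq> verts G \<and> card e = 2"
    using assms(1) unfolding finite_simple_graph_def by blast+
  interpret plane_drawing "verts G" "edges G" p \<gamma>
  proof
    fix e assume e: "e \<in> edges G"
    show "e \<subseteq> verts G" "card e = 2" using fsg(2) e by blast+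
    show "arc (\<gamma> e)" "{pathstart (\<gamma> e), pathfinish (\<gamma> e)} = p ` e"
      "(path_image (\<gamma> e) - p ` e) \<inter> p ` verts G = {}" using bspec[OF d e] by blast+
    show "(path_image (\<gamma> e) - p ` e) \<inter> path_image (\<gamma> e') = {}" if "e' \<in> edges G" "e' \<noteq> e" for e'
      using bspec[OF d e] that by blast
  qed (rule fsg(1), rule inj)
  show ?thesis using card_edges_le assms(3) unfolding triangle_free_def by blast
qed

section \<open>Recoloring sparse graphs\<close>

text \<open>The function in the last argument counts the recolorings of each vertex. Counting per vertex,
  and not just the length of the sequence, is what makes the lifting to a larger graph efficient.\<close>

inductive recolors :: "nat \<Rightarrow> 'a graph \<Rightarrow> ('a \<Rightarrow> nat) \<Rightarrow> ('a \<Rightarrow> nat) \<Rightarrow> ('a \<Rightarrow> nat) \<Rightarrow> bool"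
  for k G f where
  refl: "f \<in> proper_colorings k G \<Longrightarrow> recolors k G f f (\<lambda>_. 0)"
| step: "recolors k G f g N \<Longrightarrow> v \<in> verts G \<Longrightarrow> g(v := c) \<in> proper_colorings k G \<Longrightarrow> g v \<noteq> c \<Longrightarrow>
    recolors k G f (g(v := c)) (N(v := Suc (N v)))"

definition nbrs :: "'a graph \<Rightarrow> 'a \<Rightarrow> 'a set" where
  "nbrs G v = {w. {v, w} \<in> edges G}"

lemma recolors_proper:
  "recolors k G f g N \<Longrightarrow> f \<in> proper_colorings k G \<and> g \<in> proper_colorings k G"
  by (induction rule: recolors.induct) (simp_all del: fun_upd_apply)

lemma recolors_imp_walk:
  assumes "recolors k G f g N" "finite (verts G)"
  shows "\<exists>xs. walk (recoloring_graph k G) xs \<and> hd xs = f \<and> last xs = g \<and>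
    length xs = Suc (\<Sum>v\<in>verts G. N v)"
  using assms(1)
proof (induction rule: recolors.induct)
  case refl
  then show ?case by (intro exI[of _ "[f]"]) (simp add: walk_def recoloring_graph_def)
next
  case (step g N v c)
  then obtain xs where xs: "walk (recoloring_graph k G) xs" "hd xs = f" "last xs = g" 
    "length xs = Suc (\<Sum>v\<in>verts G. N v)" by blast
  have "{w \<in> verts G. g w \<noteq> (g(v := c)) w} = {v}" using step.hyps by auto
  then have "{g, g(v := c)} \<in> edges (recoloring_graph k G)"
    using recolors_proper[OF step.hyps(1)] step.hyps(3) unfolding recoloring_graph_def
    by (simp only: snd_conv) (rule CollectI, intro exI[of _ g] exI[of _ "g(v := c)"], simp)
  then have "walk (recoloring_graph k G) (xs @ [g(v := c)])"
    using xs step.hyps(3) unfolding walk_def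
    by (auto simp: successively_append_iff recoloring_graph_def)
  moreover have "(\<Sum>w\<in>verts G. (N(v := Suc (N v))) w) = Suc (\<Sum>w\<in>verts G. N w)"
    using assms(2) step.hyps(2) by (simp add: sum.remove[of _ v] cong: sum.cong_simp)
  moreover have "xs \<noteq> []" using xs(1) by (simp add: walk_def)
  ultimately show ?case using xs by (intro exI[of _ "xs @ [g(v := c)]"]) simp
qed

lemma recolors_graph_dist:
  assumes "recolors k G f g N" "finite (verts G)"
  shows "graph_dist (recoloring_graph k G) f g \<le> enat (\<Sum>v\<in>verts G. N v)"
proof -
  obtain xs where "walk (recoloring_graph k G) xs" "hd xs = f" "last xs = g" 
    "length xs = Suc (\<Sum>v\<in>verts G. N v)"
    using recolors_imp_walk[OF assms] by blast
  then show ?thesis unfolding graph_dist_def by (intro INF_lower2[of xs]) auto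
qed

lemma finite_nbrs: 
  assumes "finite_simple_graph G"
  shows "finite (nbrs G v)" "nbrs G v \<subseteq> verts G" "v \<notin> nbrs G v"
proof -
  have *: "{v, w} \<subseteq> verts G \<and> card {v, w} = 2" if "w \<in> nbrs G v" for w
    using that assms unfolding nbrs_def finite_simple_graph_def by blast
  then show "nbrs G v \<subseteq> verts G" by blast
  then show "finite (nbrs G v)" using assms finite_subset unfolding finite_simple_graph_def by blast
  show "v \<notin> nbrs G v" using *[of v] by auto
qed

lemma nbrs_sym: "w \<in> nbrs G v \<longleftrightarrow> v \<in> nbrs G w"
  unfolding nbrs_def by (simp add: insert_commute)

lemma proper_colorings_iff:
  "f \<in> proper_colorings k G \<longleftrightarrow> f \<in> verts G \<rightarrow>\<^sub>E {1..k} \<and> (\<forall>v. \<forall>w\<in>nbrs G v. f v \<noteq> f w)"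
  unfolding proper_colorings_def nbrs_def by blast

lemma proper_colorings_update:
  assumes "finite_simple_graph G" "g \<in> proper_colorings k G" "v \<in> verts G" "c \<in> {1..k}"
    "c \<notin> g ` nbrs G v"
  shows "g(v := c) \<in> proper_colorings k G"
  unfolding proper_colorings_iff
proof (intro conjI allI ballI)
  have g: "g \<in> verts G \<rightarrow>\<^sub>E {1..k}" "\<And>v w. w \<in> nbrs G v \<Longrightarrow> g v \<noteq> g w"
    using assms(2) unfolding proper_colorings_iff by blast+
  show "g(v := c) \<in> verts G \<rightarrow>\<^sub>E {1..k}" 
    using g(1) assms(3,4) by (auto simp: PiE_iff extensional_def)
  fix x w assume w: "w \<in> nbrs G x"
  then have "x \<noteq> w" using finite_nbrs(3)[OF assms(1)] by blast
  then show "(g(v := c)) x \<noteq> (g(v := c)) w"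
    using w nbrs_sym[of w G x] g(2)[OF w] assms(5) by auto
qed

lemma exists_free_color:
  assumes "finite (nbrs G v)" "card (nbrs G v) + 2 \<le> k"
  obtains d where "d \<in> {1..k}" "d \<noteq> c" "d \<notin> g ` nbrs G v"
proof -
  have "card (insert c (g ` nbrs G v)) \<le> Suc (card (nbrs G v))"
    using card_image_le[OF assms(1), of g] card_insert_le_m1
    by (metis Suc_le_mono card.infinite card_insert_le finite_imageI assms(1) card_insert_if le_Suc_eq le_trans)
  also have "\<dots> < card {1..k}" using assms(2) by simp
  finally have "\<not> {1..k} \<subseteq> insert c (g ` nbrs G v)"
    using card_mono[of "insert c (g ` nbrs G v)" "{1..k}"] assms(1) by fastforce
  then show thesis using that by blast
qed

text \<open>The vertices of \<open>J\<close> leave the color \<open>c\<close> one after another. A vertex avoids the colors of its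
  at most \<open>d\<close> neighbors and \<open>c\<close>, so \<open>d + 2\<close> colors suffice.\<close>

lemma recolors_clear_color:
  assumes G: "finite_simple_graph G" and k: "d + 2 \<le> k"
    and J: "finite J" "J \<subseteq> verts G" "\<And>v. v \<in> J \<Longrightarrow> card (nbrs G v) \<le> d"
    and rc: "recolors k G f g N"
  shows "\<exists>g' N'. recolors k G f g' N' \<and> (\<forall>v. v \<notin> J \<longrightarrow> g' v = g v \<and> N' v = N v) \<and>
    (\<forall>v\<in>J. g' v \<noteq> c \<and> N' v \<le> Suc (N v))"
  using J
proof (induction J rule: finite_induct)
  case empty
  then show ?case using rc by blast
next
  case (insert v J)
  then have "\<exists>g' N'. recolors k G f g' N' \<and> (\<forall>v. v \<notin> J \<longrightarrow> g' v = g v \<and> N' v = N v) \<and>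
    (\<forall>v\<in>J. g' v \<noteq> c \<and> N' v \<le> Suc (N v))" by simp
  then obtain g' N' where IH: "recolors k G f g' N'" "\<And>w. w \<notin> J \<Longrightarrow> g' w = g w \<and> N' w = N w"
    "\<And>w. w \<in> J \<Longrightarrow> g' w \<noteq> c \<and> N' w \<le> Suc (N w)" by blast
  show ?case
  proof (cases "g' v = c")
    case False
    then show ?thesis using IH insert.hyps by (intro exI[of _ g'] exI[of _ N']) auto
  next
    case True
    obtain b where b: "b \<in> {1..k}" "b \<noteq> c" "b \<notin> g' ` nbrs G v"
      using exists_free_color[of G v k c g'] finite_nbrs(1)[OF G] insert.prems k
      by (metis add_le_mono1 insertI1 le_trans)
    have "recolors k G f (g'(v := b)) (N'(v := Suc (N' v)))"
      using recolors.step[OF IH(1)] proper_colorings_update[OF G] recolors_proper[OF IH(1)] 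
        b True insert.prems by auto
    then show ?thesis
    proof (intro exI conjI)
      show "\<forall>w. w \<notin> insert v J \<longrightarrow> (g'(v := b)) w = g w \<and> (N'(v := Suc (N' v))) w = N w"
        "\<forall>w\<in>insert v J. (g'(v := b)) w \<noteq> c \<and> (N'(v := Suc (N' v))) w \<le> Suc (N w)"
        using IH insert.hyps b by auto
    qed
  qed
qed

lemma nbrs_induced: "nbrs (induced G U) v = (if v \<in> U then nbrs G v \<inter> U else {})"
  unfolding nbrs_def induced_def by auto

lemma verts_induced [simp]: "verts (induced G U) = U"
  by (simp add: induced_def)

lemma restrict_proper_coloring:
  assumes "f \<in> proper_colorings k G" "U \<subseteq> verts G"
  shows "restrict f U \<in> proper_colorings k (induced G U)"
  using assms unfolding proper_colorings_iff nbrs_induced by (auto split: if_splits)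

text \<open>A step that gives \<open>w\<close> the color \<open>c\<close> is lifted by first clearing the color \<open>c\<close> from the neighbors of \<open>w\<close>
  in \<open>I\<close>. Each of them is recolored at most once, and this is charged to the recoloring of \<open>w\<close>.\<close>

lemma recolors_extend:
  assumes G: "finite_simple_graph G" and k: "d + 2 \<le> k"
    and I: "I \<subseteq> verts G" "\<And>v. v \<in> I \<Longrightarrow> card (nbrs G v) \<le> d"
    and f: "f \<in> proper_colorings k G"
    and rc: "recolors k (induced G (verts G - I)) (restrict f (verts G - I)) g N"
  shows "\<exists>g' N'. recolors k G f g' N' \<and> (\<forall>v\<in>verts G - I. g' v = g v \<and> N' v = N v) \<and>
    (\<forall>v\<in>I. N' v \<le> (\<Sum>w\<in>nbrs G v. N w))"
  using rc
proof (induction rule: recolors.induct)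
  case refl
  show ?case using recolors.refl[OF f] by (intro exI[of _ f] exI[of _ "\<lambda>_. 0"]) auto
next
  case (step g N w c)
  let ?H = "induced G (verts G - I)"
  obtain g' N' where IH: "recolors k G f g' N'" "\<And>v. v \<in> verts G - I \<Longrightarrow> g' v = g v \<and> N' v = N v"
    "\<And>v. v \<in> I \<Longrightarrow> N' v \<le> (\<Sum>w\<in>nbrs G v. N w)" using step.IH by blast
  have w: "w \<in> verts G - I" using step.hyps(2) by simp
  define J where "J = I \<inter> nbrs G w"
  have J: "finite J" "J \<subseteq> verts G" "\<And>v. v \<in> J \<Longrightarrow> card (nbrs G v) \<le> d"
    using finite_nbrs[OF G] I unfolding J_def by auto
  have "w \<notin> J" using w by (simp add: J_def)
  obtain g'' N'' where cl: "recolors k G f g'' N''" "\<And>v. v \<notin> J \<Longrightarrow> g'' v = g' v \<and> N'' v = N' v"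
    "\<And>v. v \<in> J \<Longrightarrow> g'' v \<noteq> c \<and> N'' v \<le> Suc (N' v)"
    using recolors_clear_color[OF G k J IH(1), of c] by blast
  have V2: "g'' v = g v \<and> N'' v = N v" if "v \<in> verts G - I" for v
    using that IH(2)[OF that] cl(2)[of v] by (auto simp: J_def)
  have H: "g(w := c) \<in> (verts G - I) \<rightarrow>\<^sub>E {1..k}" 
    "\<And>v u. u \<in> nbrs ?H v \<Longrightarrow> (g(w := c)) v \<noteq> (g(w := c)) u"
    using step.hyps(3) unfolding proper_colorings_iff by auto
  have "g''(w := c) \<in> proper_colorings k G"
  proof (rule proper_colorings_update[OF G])
    show "g'' \<in> proper_colorings k G" using recolors_proper[OF cl(1)] by simp
    show "w \<in> verts G" using w by simp
    show "c \<in> {1..k}" using PiE_mem[OF H(1) w] by simp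
    show "c \<notin> g'' ` nbrs G w"
    proof
      assume "c \<in> g'' ` nbrs G w"
      then obtain u where u: "u \<in> nbrs G w" "g'' u = c" by auto
      then have "u \<in> verts G - I" using cl(3)[of u] finite_nbrs(2)[OF G, of w] by (auto simp: J_def)
      moreover have "u \<noteq> w" using u(1) finite_nbrs(3)[OF G] by blast
      ultimately show False using H(2)[of u w] u V2[of u] w by (auto simp: nbrs_induced)
    qed
  qed
  moreover have "g'' w \<noteq> c" using V2[OF w] step.hyps(4) by simp
  ultimately have rc': "recolors k G f (g''(w := c)) (N''(w := Suc (N'' w)))"
    using recolors.step[OF cl(1)] w by simp
  have "N'' v \<le> (\<Sum>u\<in>nbrs G v. (N(w := Suc (N w))) u)" if v: "v \<in> I" for v
  proof (cases "v \<in> J")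
    case True
    then have wv: "w \<in> nbrs G v" using nbrs_sym[of v G w] by (simp add: J_def)
    then have "(\<Sum>u\<in>nbrs G v. (N(w := Suc (N w))) u) = Suc (\<Sum>u\<in>nbrs G v. N u)"
      using finite_nbrs(1)[OF G, of v] by (simp add: sum.remove[of _ w] cong: sum.cong_simp)
    then show ?thesis using IH(3)[OF v] cl(3)[OF True] by simp
  next
    case False
    have "N'' v \<le> (\<Sum>u\<in>nbrs G v. N u)" using IH(3)[OF v] cl(2)[OF False] by simp
    also have "\<dots> \<le> (\<Sum>u\<in>nbrs G v. (N(w := Suc (N w))) u)" by (intro sum_mono) auto
    finally show ?thesis .
  qed
  then have sumI: "\<forall>v\<in>I. (N''(w := Suc (N'' w))) v \<le> (\<Sum>u\<in>nbrs G v. (N(w := Suc (N w))) u)"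
    using w by auto
  show ?case
  proof (intro exI conjI)
    show "recolors k G f (g''(w := c)) (N''(w := Suc (N'' w)))" by (rule rc')
    show "\<forall>v\<in>verts G - I. (g''(w := c)) v = (g(w := c)) v \<and> (N''(w := Suc (N'' w))) v = (N(w := Suc (N w))) v"
      using V2 by simp
  qed (rule sumI)
qed

text \<open>Once the neighbors of an independent set have their final colors, its vertices can take
  theirs in any order.\<close>

lemma recolors_finish:
  assumes G: "finite_simple_graph G" and b: "b \<in> proper_colorings k G"
    and J: "finite J" "J \<subseteq> verts G" "\<And>v. v \<in> J \<Longrightarrow> nbrs G v \<inter> I = {}" "J \<subseteq> I"
    and rc: "recolors k G f g N" and gb: "\<And>v. v \<in> verts G - I \<Longrightarrow> g v = b v"
  shows "\<exists>g' N'. recolors k G f g' N' \<and> (\<forall>v. v \<notin> J \<longrightarrow> g' v = g v \<and> N' v = N v) \<and>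
    (\<forall>v\<in>J. g' v = b v \<and> N' v \<le> Suc (N v))"
  using J
proof (induction J rule: finite_induct)
  case empty
  then show ?case using rc by blast
next
  case (insert v J)
  then have "\<exists>g' N'. recolors k G f g' N' \<and> (\<forall>v. v \<notin> J \<longrightarrow> g' v = g v \<and> N' v = N v) \<and>
    (\<forall>v\<in>J. g' v = b v \<and> N' v \<le> Suc (N v))" by simp
  then obtain g' N' where IH: "recolors k G f g' N'" "\<And>w. w \<notin> J \<Longrightarrow> g' w = g w \<and> N' w = N w"
    "\<And>w. w \<in> J \<Longrightarrow> g' w = b w \<and> N' w \<le> Suc (N w)" by blast
  show ?case
  proof (cases "g' v = b v")
    case True
    then show ?thesis using IH insert.hyps by (intro exI[of _ g'] exI[of _ N']) auto
  next
    case False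
    have v: "v \<in> verts G" using insert.prems by simp
    have bp: "b \<in> verts G \<rightarrow>\<^sub>E {1..k}" "\<And>w. w \<in> nbrs G v \<Longrightarrow> b v \<noteq> b w"
      using b unfolding proper_colorings_iff by auto
    have "g' w = b w" if "w \<in> nbrs G v" for w
    proof -
      have "w \<in> verts G - I" using that insert.prems(2)[of v] finite_nbrs(2)[OF G, of v] by auto
      then show ?thesis using IH(2,3)[of w] gb by (cases "w \<in> J") auto
    qed
    then have "b v \<notin> g' ` nbrs G v" using bp(2) by auto
    then have "g'(v := b v) \<in> proper_colorings k G"
      using recolors_proper[OF IH(1)] PiE_mem[OF bp(1) v] by (intro proper_colorings_update[OF G _ v]) auto
    then have "recolors k G f (g'(v := b v)) (N'(v := Suc (N' v)))"
      using recolors.step[OF IH(1) v _ False] by simp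
    then show ?thesis
    proof (intro exI conjI)
      show "\<forall>w. w \<notin> insert v J \<longrightarrow> (g'(v := b v)) w = g w \<and> (N'(v := Suc (N' v))) w = N w"
        "\<forall>w\<in>insert v J. (g'(v := b v)) w = b w \<and> (N'(v := Suc (N' v))) w \<le> Suc (N w)"
        using IH insert.hyps by auto
    qed
  qed
qed

definition independent :: "'a graph \<Rightarrow> 'a set \<Rightarrow> bool" where
  "independent G I \<longleftrightarrow> (\<forall>v\<in>I. nbrs G v \<inter> I = {})"

lemma card_nbrs_le_vdegree: 
  assumes "finite_simple_graph G"
  shows "card (nbrs G v) \<le> vdegree G v"
  unfolding vdegree_def
proof (rule card_inj_on_le[of "\<lambda>w. {v, w}"])
  show "inj_on (\<lambda>w. {v, w}) (nbrs G v)" by (auto simp: inj_on_def doubleton_eq_iff)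
  show "(\<lambda>w. {v, w}) ` nbrs G v \<subseteq> {e \<in> edges G. v \<in> e}" by (auto simp: nbrs_def)
  have "edges G \<subseteq> Pow (verts G)" "finite (verts G)" using assms by (auto simp: finite_simple_graph_def)
  then have "finite (edges G)" using finite_subset by blast
  then show "finite {e \<in> edges G. v \<in> e}" by simp
qed

lemma handshake:
  assumes "finite_simple_graph G"
  shows "(\<Sum>v\<in>verts G. vdegree G v) = 2 * card (edges G)"
proof -
  have G: "\<And>e. e \<in> edges G \<Longrightarrow> e \<subseteq> verts G \<and> card e = 2" "finite (verts G)" 
    using assms by (auto simp: finite_simple_graph_def)
  have "finite (edges G)" by (rule finite_subset[of _ "Pow (verts G)"]) (use G in auto)
  have "(\<Sum>v\<in>verts G. vdegree G v) = (\<Sum>e\<in>edges G. card {v \<in> verts G. v \<in> e})"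
    unfolding vdegree_def
    by (rule sum_multicount_gen[symmetric, OF \<open>finite (edges G)\<close> G(2)]) simp
  also have "\<dots> = (\<Sum>e\<in>edges G. 2)"
  proof (rule sum.cong[OF HOL.refl])
    fix e assume e: "e \<in> edges G"
    then have "{v \<in> verts G. v \<in> e} = e" using G(1) by blast
    then show "card {v \<in> verts G. v \<in> e} = 2" using G(1)[OF e] by simp
  qed
  finally show ?thesis by simp
qed

text \<open>The degrees sum to at most \<open>4 n\<close>, and the vertices outside the set contribute at least 5 each.\<close>

lemma many_low_degree_vertices:
  assumes "finite_simple_graph G" "card (edges G) \<le> 2 * card (verts G)"
  shows "card (verts G) \<le> 5 * card {v \<in> verts G. card (nbrs G v) \<le> 4}"
proof -
  let ?L = "{v \<in> verts G. card (nbrs G v) \<le> 4}"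
  have fin: "finite (verts G)" using assms by (simp add: finite_simple_graph_def)
  have "5 * card (verts G - ?L) \<le> (\<Sum>v\<in>verts G - ?L. vdegree G v)"
  proof -
    have "5 \<le> vdegree G v" if "v \<in> verts G - ?L" for v
    proof -
      have "card (nbrs G v) > 4" using that by auto
      then show ?thesis using card_nbrs_le_vdegree[OF assms(1), of v] by linarith
    qed
    then show ?thesis using sum_bounded_below[of "verts G - ?L" 5 "vdegree G"] by (simp add: mult.commute)
  qed
  also have "\<dots> \<le> (\<Sum>v\<in>verts G. vdegree G v)" using fin by (intro sum_mono2) auto
  also have "\<dots> \<le> 4 * card (verts G)" using handshake[OF assms(1)] assms(2) by simp
  finally have "5 * card (verts G - ?L) \<le> 4 * card (verts G)" .
  moreover have "card (verts G - ?L) = card (verts G) - card ?L" using fin by (intro card_Diff_subset) auto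
  ultimately show ?thesis by linarith
qed

text \<open>In a maximal independent set \<open>I\<close> every vertex of \<open>L\<close> is in \<open>I\<close> or next to a vertex of \<open>I\<close>.\<close>

lemma greedy_independent_set:
  assumes G: "finite_simple_graph G" and L: "L \<subseteq> verts G" "\<And>v. v \<in> L \<Longrightarrow> card (nbrs G v) \<le> d"
  obtains I where "I \<subseteq> L" "independent G I" "card L \<le> (d + 1) * card I"
proof -
  have fin: "finite L" using G L(1) finite_subset unfolding finite_simple_graph_def by blast
  have "{} \<in> {I. I \<subseteq> L \<and> independent G I}" by (simp add: independent_def)
  then have "{I. I \<subseteq> L \<and> independent G I} \<noteq> {}" by blast
  moreover have "finite {I. I \<subseteq> L \<and> independent G I}" using fin by simp
  ultimately obtain I where "I \<in> {I. I \<subseteq> L \<and> independent G I}" 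
    and mx: "\<forall>J\<in>{I. I \<subseteq> L \<and> independent G I}. I \<subseteq> J \<longrightarrow> I = J"
    using finite_has_maximal by metis
  then have I: "I \<subseteq> L" "independent G I" by simp_all
  have max: "I = J" if "J \<subseteq> L" "independent G J" "I \<subseteq> J" for J using mx that by simp
  have "L \<subseteq> (\<Union>v\<in>I. insert v (nbrs G v))"
  proof
    fix w assume w: "w \<in> L"
    show "w \<in> (\<Union>v\<in>I. insert v (nbrs G v))"
    proof (rule ccontr)
      assume *: "w \<notin> (\<Union>v\<in>I. insert v (nbrs G v))"
      then have "w \<notin> nbrs G v \<and> v \<notin> nbrs G w" if "v \<in> I" for v
        using that nbrs_sym[of w G v] by blast
      then have "independent G (insert w I)"
        using I(2) finite_nbrs(3)[OF G, of w] unfolding independent_def by blast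
      then have "I = insert w I" using max[of "insert w I"] w I(1) by auto
      then show False using * by blast
    qed
  qed
  then have "card L \<le> card (\<Union>v\<in>I. insert v (nbrs G v))"
    using finite_subset[OF I(1) fin] finite_nbrs(1)[OF G] by (intro card_mono) auto
  also have "\<dots> \<le> (\<Sum>v\<in>I. card (insert v (nbrs G v)))"
    using finite_subset[OF I(1) fin] by (rule card_UN_le)
  also have "\<dots> \<le> (\<Sum>v\<in>I. d + 1)"
    using L(2) I(1) finite_nbrs[OF G] by (intro sum_mono) (auto simp: subset_iff)
  also have "\<dots> = (d + 1) * card I" by simp
  finally show thesis using that I by blast
qed

text \<open>The exponent is a solution of \<open>5 * (24 / 25) ^ e \<le> 1\<close>. For \<open>m > 0\<close> the summand 1 is absorbed by
  a fifth copy of \<open>m ^ 40\<close>.\<close>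

lemma power_40_bound:
  fixes m n :: nat
  assumes "25 * m \<le> 24 * n" "n > 0"
  shows "4 * m ^ 40 + 1 \<le> n ^ 40"
proof (cases "m = 0")
  case True then show ?thesis using assms by (simp add: Suc_le_eq)
next
  case False
  have "(25 * m) ^ 40 \<le> (24 * n) ^ 40" using assms(1) by (rule power_mono) simp
  then have "5 * 25 ^ 40 * m ^ 40 \<le> 5 * 24 ^ 40 * n ^ 40" unfolding power_mult_distrib by linarith
  also have "\<dots> \<le> 25 ^ 40 * n ^ 40" by (intro mult_right_mono) simp_all
  finally have "25 ^ 40 * (5 * m ^ 40) \<le> 25 ^ 40 * n ^ 40" by (simp only: mult_ac)
  then have "5 * m ^ 40 \<le> n ^ 40" by (rule mult_left_le_imp_le) simp
  moreover have "m ^ 40 \<ge> 1" using False by simp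
  ultimately show ?thesis by linarith
qed

definition sparse :: "'a graph \<Rightarrow> bool" where
  "sparse G \<longleftrightarrow> (\<forall>U\<subseteq>verts G. card (edges (induced G U)) \<le> 2 * card U)"

lemma induced_induced: "W \<subseteq> U \<Longrightarrow> induced (induced G U) W = induced G W"
  unfolding induced_def by auto

lemma induced_verts: "finite_simple_graph G \<Longrightarrow> induced G (verts G) = G"
  unfolding induced_def finite_simple_graph_def by (rule prod_eqI) auto

lemma finite_simple_induced: 
  "finite_simple_graph G \<Longrightarrow> U \<subseteq> verts G \<Longrightarrow> finite_simple_graph (induced G U)"
  unfolding finite_simple_graph_def induced_def using finite_subset by auto

text \<open>Recolor \<open>G - I\<close> by induction, lift the sequence, and finish on \<open>I\<close>. A vertex of \<open>I\<close> has at most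
  four neighbors, each recolored at most \<open>m ^ 40\<close> times, where \<open>m\<close> is the order of \<open>G - I\<close>.\<close>

theorem sparse_recolors:
  assumes "finite_simple_graph G" "sparse G" "6 \<le> k"
    "a \<in> proper_colorings k G" "b \<in> proper_colorings k G"
  shows "\<exists>N. recolors k G a b N \<and> (\<forall>v\<in>verts G. N v \<le> card (verts G) ^ 40)"
  using assms
proof (induction "card (verts G)" arbitrary: G a b rule: less_induct)
  case (less G a b)
  note G = less.prems(1) and ab = less.prems(4,5)
  have fin: "finite (verts G)" using G by (simp add: finite_simple_graph_def)
  show ?case
  proof (cases "verts G = {}")
    case True
    then have "a = b" using ab unfolding proper_colorings_iff by auto
    then show ?thesis using recolors.refl[OF ab(1)] True by (intro exI[of _ "\<lambda>_. 0"]) auto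
  next
    case False
    define L where "L = {v \<in> verts G. card (nbrs G v) \<le> 4}"
    have "card (edges G) \<le> 2 * card (verts G)"
      using less.prems(2) induced_verts[OF G] unfolding sparse_def by (metis order_refl)
    then have cL: "card (verts G) \<le> 5 * card L" 
      unfolding L_def by (rule many_low_degree_vertices[OF G])
    obtain I where I: "I \<subseteq> L" "independent G I" "card L \<le> (4 + 1) * card I"
      using greedy_independent_set[OF G, of L 4] unfolding L_def by blast
    have IV: "I \<subseteq> verts G" and deg: "\<And>v. v \<in> I \<Longrightarrow> card (nbrs G v) \<le> 4" using I(1) by (auto simp: L_def)
    have finI: "finite I" using IV fin finite_subset by blast
    let ?U = "verts G - I" 
    have cU: "card ?U = card (verts G) - card I" using finI IV by (rule card_Diff_subset)
    have n: "card (verts G) > 0" using False fin by (simp add: card_gt_0_iff)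
    have "card L \<le> 5 * card I" using I(3) by simp
    then have "card (verts G) \<le> 25 * card I" using cL by linarith
    then have m: "25 * card ?U \<le> 24 * card (verts G)" using cU by simp
    have "card (verts (induced G ?U)) < card (verts G)" using m n by simp
    moreover have "sparse (induced G ?U)"
      unfolding sparse_def
    proof (intro allI impI)
      fix W assume "W \<subseteq> verts (induced G ?U)"
      then have W: "W \<subseteq> ?U" by simp
      then show "card (edges (induced (induced G ?U) W)) \<le> 2 * card W"
        using less.prems(2) unfolding sparse_def induced_induced[OF W] by blast
    qed
    ultimately obtain N where N: "recolors k (induced G ?U) (restrict a ?U) (restrict b ?U) N"
      "\<And>v. v \<in> ?U \<Longrightarrow> N v \<le> card ?U ^ 40"
      using less.hyps[of "induced G ?U" "restrict a ?U" "restrict b ?U"] finite_simple_induced[OF G]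
        restrict_proper_coloring ab assms(3) by (metis Diff_subset verts_induced)
    have k: "4 + 2 \<le> k" using assms(3) by simp
    obtain g1 N1 where 1: "recolors k G a g1 N1" "\<And>v. v \<in> ?U \<Longrightarrow> g1 v = restrict b ?U v \<and> N1 v = N v"
      "\<And>v. v \<in> I \<Longrightarrow> N1 v \<le> (\<Sum>w\<in>nbrs G v. N w)"
      using recolors_extend[OF G k IV deg ab(1) N(1)] by blast
    have ind: "\<And>v. v \<in> I \<Longrightarrow> nbrs G v \<inter> I = {}" using I(2) by (simp add: independent_def)
    have "\<And>v. v \<in> ?U \<Longrightarrow> g1 v = b v" using 1(2) by simp
    then obtain g2 N2 where 2: "recolors k G a g2 N2" "\<And>v. v \<notin> I \<Longrightarrow> g2 v = g1 v \<and> N2 v = N1 v"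
      "\<And>v. v \<in> I \<Longrightarrow> g2 v = b v \<and> N2 v \<le> Suc (N1 v)"
      using recolors_finish[OF G ab(2) finI IV ind subset_refl 1(1)] by blast
    have "g2 = b"
    proof (rule extensionalityI[of _ "verts G"])
      show "g2 \<in> extensional (verts G)" "b \<in> extensional (verts G)"
        using recolors_proper[OF 2(1)] ab(2) unfolding proper_colorings_iff by (auto simp: PiE_iff)
      show "g2 v = b v" if "v \<in> verts G" for v 
        using that 1(2)[of v] 2(2,3)[of v] by (cases "v \<in> I") auto
    qed
    moreover have "N2 v \<le> card (verts G) ^ 40" if v: "v \<in> verts G" for v
    proof (cases "v \<in> I")
      case False
      then have "N2 v \<le> card ?U ^ 40" using v 1(2)[of v] 2(2)[of v] N(2)[of v] by simp
      also have "\<dots> \<le> card (verts G) ^ 40" using m by (intro power_mono) auto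
      finally show ?thesis .
    next
      case True
      have "nbrs G v \<subseteq> ?U" using ind[OF True] finite_nbrs(2)[OF G, of v] by blast
      then have "(\<Sum>w\<in>nbrs G v. N w) \<le> card (nbrs G v) * card ?U ^ 40"
        using sum_bounded_above[of "nbrs G v" N "card ?U ^ 40"] N(2) by auto
      also have "\<dots> \<le> 4 * card ?U ^ 40" using deg[OF True] by simp
      finally have "N2 v \<le> 4 * card ?U ^ 40 + 1" using 1(3)[OF True] 2(3)[OF True] by linarith
      also have "\<dots> \<le> card (verts G) ^ 40" by (rule power_40_bound[OF m n])
      finally show ?thesis .
    qed
    ultimately show ?thesis using 2(1) by blast
  qed
qed

theorem sparse_recoloring_diam:
  assumes "finite_simple_graph G" "sparse G" "6 \<le> k"
  shows "graph_diam (recoloring_graph k G) \<le> enat (card (verts G) ^ 41)"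
  unfolding graph_diam_def
proof (intro SUP_least)
  fix a b assume "a \<in> verts (recoloring_graph k G)" "b \<in> verts (recoloring_graph k G)"
  then have "a \<in> proper_colorings k G" "b \<in> proper_colorings k G" by (simp_all add: recoloring_graph_def)
  then obtain N where N: "recolors k G a b N" "\<And>v. v \<in> verts G \<Longrightarrow> N v \<le> card (verts G) ^ 40"
    using sparse_recolors[OF assms] by blast
  have "graph_dist (recoloring_graph k G) a b \<le> enat (\<Sum>v\<in>verts G. N v)"
    using recolors_graph_dist[OF N(1)] assms(1) by (simp add: finite_simple_graph_def)
  also have "(\<Sum>v\<in>verts G. N v) \<le> card (verts G) * card (verts G) ^ 40"
    using sum_bounded_above[of "verts G" N] N(2) by simp
  also have "\<dots> = card (verts G) ^ 41" by (simp flip: power_Suc)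
  finally show "graph_dist (recoloring_graph k G) a b \<le> enat (card (verts G) ^ 41)" by simp
qed

lemma planar_induced:
  assumes "planar G" "U \<subseteq> verts G"
  shows "planar (induced G U)"
proof -
  from assms(1) obtain p :: "'a \<Rightarrow> complex" and \<gamma> where inj: "inj_on p (verts G)"
    and d: "\<forall>e\<in>edges G. arc (\<gamma> e) \<and> {pathstart (\<gamma> e), pathfinish (\<gamma> e)} = p ` e \<and>
           (path_image (\<gamma> e) - p ` e) \<inter> p ` verts G = {} \<and>
           (\<forall>e'\<in>edges G. e' \<noteq> e \<longrightarrow> (path_image (\<gamma> e) - p ` e) \<inter> path_image (\<gamma> e') = {})"
    unfolding planar_def by (elim exE conjE) (rule that)
  show ?thesis
    unfolding planar_def induced_def fst_conv snd_conv
  proof (intro exI[of _ p] exI[of _ \<gamma>] conjI ballI impI)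
    show "inj_on p U" using inj assms(2) inj_on_subset by blast
    fix e assume "e \<in> {e \<in> edges G. e \<subseteq> U}"
    then have e: "e \<in> edges G" by simp
    show "arc (\<gamma> e)" "{pathstart (\<gamma> e), pathfinish (\<gamma> e)} = p ` e" using bspec[OF d e] by blast+
    have "(path_image (\<gamma> e) - p ` e) \<inter> p ` verts G = {}" using bspec[OF d e] by blast
    then show "(path_image (\<gamma> e) - p ` e) \<inter> p ` U = {}" using assms(2) by blast
    fix e' assume "e' \<in> {e \<in> edges G. e \<subseteq> U}" "e' \<noteq> e"
    then show "(path_image (\<gamma> e) - p ` e) \<inter> path_image (\<gamma> e') = {}" using bspec[OF d e] by blast
  qed
qed

lemma triangle_free_induced: "triangle_free G \<Longrightarrow> triangle_free (induced G U)"
  unfolding triangle_free_def induced_def by auto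

section \<open>Nested squares\<close>

text \<open>The vertex \<open>4 * j + q\<close> is corner \<open>q\<close> of square \<open>j\<close>; the squares are numbered from the inside, and
  vertex \<open>v + 4\<close> is the corner of the next square in the same direction.\<close>

definition ring_edge :: "nat \<Rightarrow> nat \<Rightarrow> nat set" where
  "ring_edge j q = {4 * j + q, 4 * j + (q + 1) mod 4}"

definition spoke :: "nat \<Rightarrow> nat set" where
  "spoke v = {v, v + 4}"

text \<open>The at most three vertices left over when 4 does not divide \<open>n\<close> are isolated, so that every
  order is attained.\<close>

definition nested_squares :: "nat \<Rightarrow> nat graph" where
  "nested_squares n = ({..<n}, 
     {ring_edge j q | j q. j < n div 4 \<and> q < 4} \<union> {spoke v | v. v + 4 < 4 * (n div 4)})"

lemma nested_squares_edge_cases: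
  assumes "e \<in> edges (nested_squares n)"
  obtains (ring) j q where "e = ring_edge j q" "j < n div 4" "q < 4"
    | (spoke) v where "e = spoke v" "v + 4 < 4 * (n div 4)"
  using assms unfolding nested_squares_def by auto

lemma less_4_cases:
  assumes "q < (4::nat)"
  obtains "q = 0" | "q = 1" | "q = 2" | "q = 3"
  using assms by linarith

lemma ring_edge_neq: "q < 4 \<Longrightarrow> 4 * j + q \<noteq> 4 * j + (q + 1) mod (4::nat)"
  by (erule less_4_cases) simp_all

lemma nested_squares_simple: "finite_simple_graph (nested_squares n)"
  unfolding finite_simple_graph_def
proof (intro conjI ballI)
  show "finite (verts (nested_squares n))" by (simp add: nested_squares_def)
  fix e assume "e \<in> edges (nested_squares n)"
  then have "e \<subseteq> verts (nested_squares n) \<and> card e = 2"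
  proof (cases rule: nested_squares_edge_cases)
    case (ring j q)
    have "4 * j + 4 \<le> n" using ring(2) by presburger
    then have "4 * j + x < n" if "x < 4" for x using that by linarith
    then have "4 * j + q < n" "4 * j + (q + 1) mod 4 < n" using ring(3) by simp_all
    then have "e \<subseteq> verts (nested_squares n)" by (simp add: ring(1) ring_edge_def nested_squares_def)
    moreover have "card e = 2" using ring_edge_neq[OF ring(3), of j] by (simp add: ring(1) ring_edge_def)
    ultimately show ?thesis ..
  next
    case (spoke v)
    then have "v + 4 < n" by presburger
    then show ?thesis by (simp add: spoke(1) spoke_def nested_squares_def)
  qed
  then show "e \<subseteq> verts (nested_squares n)" "card e = 2" by simp_all
qed

definition parity :: "nat \<Rightarrow> bool" where
  "parity v = even (v div 4 + v mod 4)"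

lemma edge_changes_parity:
  assumes "{x, y} \<in> edges (nested_squares n)"
  shows "parity x \<noteq> parity y"
  using assms
proof (cases rule: nested_squares_edge_cases)
  case (ring j q)
  have par: "parity (4 * j + x) = even (j + x)" if "x < 4" for x
    using that by (simp add: parity_def)
  have "even (j + q) \<noteq> even (j + (q + 1) mod 4)"
    using ring(3) by (cases rule: less_4_cases) simp_all
  then have "parity (4 * j + q) \<noteq> parity (4 * j + (q + 1) mod 4)"
    using ring(3) by (simp add: par)
  then show ?thesis using ring(1) by (auto simp: ring_edge_def doubleton_eq_iff)
next
  case (spoke v)
  have "parity v \<noteq> parity (v + 4)" by (simp add: parity_def)
  then show ?thesis using spoke(1) by (auto simp: spoke_def doubleton_eq_iff)
qed

lemma nested_squares_triangle_free: "triangle_free (nested_squares n)"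
  unfolding triangle_free_def using edge_changes_parity by metis

text \<open>Corner \<open>q\<close> of square \<open>j\<close> lies on the half-axis through \<open>\<i> ^ q\<close> at distance \<open>j + 1\<close>.\<close>

definition position :: "nat \<Rightarrow> complex" where
  "position v = \<i> ^ (v mod 4) * of_nat (v div 4 + 1)"

text \<open>Every nonzero point has unique coordinates of this kind, where each quadrant contains only one
  of its two half-axes. Vertices have \<open>b = 0\<close> and integral \<open>a\<close>, the interiors of spokes have \<open>b = 0\<close>
  and nonintegral \<open>a\<close>, and the interiors of sides have \<open>b > 0\<close> and integral \<open>a + b\<close>. Therefore the
  coordinates of a point determine the edge on which it lies.\<close>

definition quadrant_coords :: "complex \<Rightarrow> nat \<Rightarrow> real \<Rightarrow> real \<Rightarrow> bool" where
  "quadrant_coords z q a b \<longleftrightarrow> q < 4 \<and> a > 0 \<and> b \<ge> 0 \<and> z = \<i> ^ q * Complex a b"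

lemma quadrant_coords_unique:
  assumes "quadrant_coords z q a b" "quadrant_coords z q' a' b'"
  shows "q = q' \<and> a = a' \<and> b = b'"
proof -
  have p: "\<i> ^ 0 * Complex a b = Complex a b" "\<i> ^ 1 * Complex a b = Complex (-b) a"
    "\<i> ^ 2 * Complex a b = Complex (-a) (-b)" "\<i> ^ 3 * Complex a b = Complex b (-a)" for a b
    by (simp_all add: complex_eq_iff numeral_3_eq_3)
  have q: "q = 0 \<or> q = 1 \<or> q = 2 \<or> q = 3" "q' = 0 \<or> q' = 1 \<or> q' = 2 \<or> q' = 3"
    using assms unfolding quadrant_coords_def by linarith+
  have eq: "\<i> ^ q * Complex a b = \<i> ^ q' * Complex a' b'" "a > 0" "a' > 0" "b \<ge> 0" "b' \<ge> 0"
    using assms unfolding quadrant_coords_def by auto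
  show ?thesis using q eq by (elim disjE) (simp_all only: p complex.inject, auto)
qed

lemma position_coords: "quadrant_coords (position v) (v mod 4) (real (v div 4 + 1)) 0"
  unfolding quadrant_coords_def position_def by (simp add: complex_eq_iff)

lemma inj_position: "inj position"
proof (rule injI)
  fix v w assume "position v = position w"
  then have "v mod 4 = w mod 4 \<and> real (v div 4 + 1) = real (w div 4 + 1) \<and> (0::real) = 0"
    using quadrant_coords_unique position_coords by metis
  then show "v = w" by (metis add_right_cancel div_mult_mod_eq of_nat_eq_iff)
qed

text \<open>The minimum and the maximum merely select an orientation of the segment.\<close>

definition drawn_edge :: "nat set \<Rightarrow> real \<Rightarrow> complex" where
  "drawn_edge e = linepath (position (Min e)) (position (Max e))"

lemma drawn_edge_doubleton:
  assumes "v \<noteq> w"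
  shows "arc (drawn_edge {v, w})" 
    "{pathstart (drawn_edge {v, w}), pathfinish (drawn_edge {v, w})} = position ` {v, w}"
    "path_image (drawn_edge {v, w}) - position ` {v, w} = open_segment (position v) (position w)"
proof -
  have "position v \<noteq> position w" using assms inj_position by (simp add: inj_eq)
  moreover have "Min {v, w} = min v w" "Max {v, w} = max v w" by simp_all
  ultimately show "arc (drawn_edge {v, w})" 
    "{pathstart (drawn_edge {v, w}), pathfinish (drawn_edge {v, w})} = position ` {v, w}"
    "path_image (drawn_edge {v, w}) - position ` {v, w} = open_segment (position v) (position w)"
    unfolding drawn_edge_def 
    by (auto simp: min_def max_def open_segment_def closed_segment_commute insert_commute)
qed

lemma ring_edge_interior:
  assumes "z \<in> path_image (drawn_edge (ring_edge j q)) - position ` ring_edge j q" "q < 4"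
  obtains a b where "quadrant_coords z q a b" "b > 0" "a + b = real (j + 1)"
proof -
  have pos: "position (4 * j + q) = \<i> ^ q * of_nat (j + 1)" 
    using assms(2) by (simp add: position_def)
  have "\<i> ^ ((q + 1) mod 4) = \<i> ^ (q + 1)"
    using assms(2) by (cases rule: less_4_cases) (simp_all add: power4_eq_xxxx)
  then have pos': "position (4 * j + (q + 1) mod 4) = \<i> ^ q * (\<i> * of_nat (j + 1))"
    by (simp add: position_def)
  have "z \<in> open_segment (position (4 * j + q)) (position (4 * j + (q + 1) mod 4))"
    using assms(1) drawn_edge_doubleton(3)[OF ring_edge_neq[OF assms(2)]] unfolding ring_edge_def by blast
  then obtain t where t: "0 < t" "t < 1" 
    "z = (1 - t) *\<^sub>R position (4 * j + q) + t *\<^sub>R position (4 * j + (q + 1) mod 4)"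
    by (auto simp: in_segment)
  show thesis
  proof
    have "z = \<i> ^ q * Complex ((1 - t) * real (j + 1)) (t * real (j + 1))"
      unfolding t(3) pos pos' by (simp add: complex_eq_iff scaleR_conv_of_real algebra_simps Complex_eq)
    then show "quadrant_coords z q ((1 - t) * real (j + 1)) (t * real (j + 1))"
      using t(1,2) assms(2) by (simp add: quadrant_coords_def)
    show "t * real (j + 1) > 0" using t(1) by simp
    show "(1 - t) * real (j + 1) + t * real (j + 1) = real (j + 1)" by (simp add: algebra_simps)
  qed
qed

lemma spoke_interior:
  assumes "z \<in> path_image (drawn_edge (spoke v)) - position ` spoke v"
  obtains a where "quadrant_coords z (v mod 4) a 0" "real (v div 4 + 1) < a" "a < real (v div 4 + 2)"
proof -
  have "v \<noteq> v + 4" by simp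
  then have "z \<in> open_segment (position v) (position (v + 4))"
    using assms drawn_edge_doubleton(3)[of v "v + 4"] unfolding spoke_def by blast
  then obtain t where t: "0 < t" "t < 1" "z = (1 - t) *\<^sub>R position v + t *\<^sub>R position (v + 4)"
    by (auto simp: in_segment)
  show thesis
  proof
    have "z = \<i> ^ (v mod 4) * Complex (real (v div 4 + 1) + t) 0"
      unfolding t(3) position_def by (simp add: scaleR_conv_of_real algebra_simps Complex_eq)
    then show "quadrant_coords z (v mod 4) (real (v div 4 + 1) + t) 0"
      using t(1,2) by (simp add: quadrant_coords_def)
  qed (use t in simp_all)
qed

lemma edge_interiors_disjoint:
  assumes e: "e \<in> edges (nested_squares n)" and f: "f \<in> edges (nested_squares n)"
    and z: "z \<in> path_image (drawn_edge e) - position ` e" "z \<in> path_image (drawn_edge f) - position ` f"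
  shows "e = f"
  using e
proof (cases rule: nested_squares_edge_cases)
  case (ring j q)
  obtain a b where ab: "quadrant_coords z q a b" "b > 0" "a + b = real (j + 1)"
    using ring_edge_interior[of z j q] z(1) ring by metis
  show ?thesis using f
  proof (cases rule: nested_squares_edge_cases)
    case (ring j' q')
    obtain a' b' where "quadrant_coords z q' a' b'" "a' + b' = real (j' + 1)"
      using ring_edge_interior[of z j' q'] z(2) ring by metis
    then have "q = q'" "real (j + 1) = real (j' + 1)" using quadrant_coords_unique[OF ab(1)] ab(3) by metis+
    then show ?thesis using ring(1) \<open>e = ring_edge j q\<close> by simp
  next
    case (spoke w)
    obtain a' where "quadrant_coords z (w mod 4) a' 0" using spoke_interior[of z w] z(2) spoke by metis
    then show ?thesis using quadrant_coords_unique[OF ab(1)] ab(2) by force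
  qed
next
  case (spoke v)
  obtain a where a: "quadrant_coords z (v mod 4) a 0" "real (v div 4 + 1) < a" "a < real (v div 4 + 2)"
    using spoke_interior[of z v] z(1) spoke by metis
  show ?thesis using f
  proof (cases rule: nested_squares_edge_cases)
    case (ring j' q')
    obtain a' b' where "quadrant_coords z q' a' b'" "b' > 0"
      using ring_edge_interior[of z j' q'] z(2) ring by metis
    then show ?thesis using quadrant_coords_unique[OF a(1)] by force
  next
    case (spoke w)
    obtain a' where a': "quadrant_coords z (w mod 4) a' 0" "real (w div 4 + 1) < a'" "a' < real (w div 4 + 2)" 
      using spoke_interior[of z w] z(2) spoke by metis
    then have "v mod 4 = w mod 4" "a = a'" using quadrant_coords_unique[OF a(1) a'(1)] by simp_all
    moreover have "v div 4 + 1 < w div 4 + 2" "w div 4 + 1 < v div 4 + 2"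
      using a(2,3) a'(2,3) \<open>a = a'\<close> by (metis less_trans of_nat_less_iff)+
    then have "v div 4 = w div 4" by linarith
    ultimately have "v = w" by (metis div_mult_mod_eq)
    then show ?thesis using spoke(1) \<open>e = spoke v\<close> by simp
  qed
qed

lemma edge_interior_no_vertex:
  assumes e: "e \<in> edges (nested_squares n)" and z: "z \<in> path_image (drawn_edge e) - position ` e"
  shows "z \<noteq> position w"
proof
  assume zw: "z = position w"
  show False using e
  proof (cases rule: nested_squares_edge_cases)
    case (ring j q)
    obtain a b where ab: "quadrant_coords z q a b" "b > 0"
      using ring_edge_interior[of z j q] z(1) ring by metis
    then show ?thesis using quadrant_coords_unique[OF ab(1)] position_coords[of w] zw by force
  next
    case (spoke v)
    obtain a where a: "quadrant_coords z (v mod 4) a 0" "real (v div 4 + 1) < a" "a < real (v div 4 + 2)"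
      using spoke_interior[of z v] z spoke by metis
    have "a = real (w div 4 + 1)" using quadrant_coords_unique[OF a(1)] position_coords[of w] zw by metis
    then have "v div 4 + 1 < w div 4 + 1" "w div 4 + 1 < v div 4 + 2" using a(2,3) by (simp_all only: of_nat_less_iff)
    then show ?thesis by linarith
  qed
qed

lemma nested_squares_planar: "planar (nested_squares n)"
  unfolding planar_def
proof (intro exI[of _ position] exI[of _ drawn_edge] conjI ballI impI)
  show "inj_on position (verts (nested_squares n))" using inj_position inj_on_subset by blast
  fix e assume e: "e \<in> edges (nested_squares n)"
  then have "card e = 2" using nested_squares_simple unfolding finite_simple_graph_def by blast
  then obtain v w where vw: "e = {v, w}" "v \<noteq> w" by (auto simp: card_2_iff)
  show "arc (drawn_edge e)" "{pathstart (drawn_edge e), pathfinish (drawn_edge e)} = position ` e"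
    unfolding vw(1) using drawn_edge_doubleton[OF vw(2)] by auto
  show "(path_image (drawn_edge e) - position ` e) \<inter> position ` verts (nested_squares n) = {}"
    using edge_interior_no_vertex[OF e] by blast
  fix f assume f: "f \<in> edges (nested_squares n)" "f \<noteq> e"
  show "(path_image (drawn_edge e) - position ` e) \<inter> path_image (drawn_edge f) = {}"
    using edge_interior_no_vertex[OF e] edge_interiors_disjoint[OF e f(1)] f(2) by blast
qed

lemma four_neighbours_vdegree:
  assumes G: "finite_simple_graph G" and v: "v \<in> U" 
    and W: "card W = 4" "W \<subseteq> U" "\<And>w. w \<in> W \<Longrightarrow> {v, w} \<in> edges G"
  shows "vdegree (induced G U) v \<ge> 4"
proof -
  let ?E = "{e \<in> edges (induced G U). v \<in> e}"
  have "inj_on (\<lambda>w. {v, w}) W" by (auto simp: inj_on_def doubleton_eq_iff)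
  then have "card ((\<lambda>w. {v, w}) ` W) = 4" using W(1) by (simp add: card_image)
  moreover have "(\<lambda>w. {v, w}) ` W \<subseteq> ?E" using v W by (auto simp: induced_def)
  moreover have "finite ?E"
    by (rule finite_subset[of _ "Pow (verts G)"]) (use G in \<open>auto simp: finite_simple_graph_def induced_def\<close>)
  ultimately show ?thesis unfolding vdegree_def using card_mono by metis
qed

text \<open>The neighbors in the same square are at the offsets 1 and 3 modulo 4; the third claim records
  that all four are at most one square away from square \<open>j\<close>.\<close>

lemma inner_vertex_neighbours:
  assumes "q < 4" "0 < j" "j + 1 < n div 4"
  obtains W where "card W = 4" "\<And>w. w \<in> W \<Longrightarrow> {4 * j + q, w} \<in> edges (nested_squares n)"
    "\<And>w. w \<in> W \<Longrightarrow> \<exists>j' q'. w = 4 * j' + q' \<and> q' < 4 \<and> j - 1 \<le> j' \<and> j' \<le> j + 1"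
proof
  let ?W = "{4 * j + (q + 1) mod 4, 4 * j + (q + 3) mod 4, 4 * (j + 1) + q, 4 * (j - 1) + q}"
  show "card ?W = 4" using assms(1,2) by (cases rule: less_4_cases) auto
  have q: "((q + 3) mod 4 + 1) mod 4 = q" using assms(1) by (cases rule: less_4_cases) simp_all
  have "ring_edge i b \<in> edges (nested_squares n)" if "i < n div 4" "b < 4" for i b
    using that unfolding nested_squares_def by auto
  then have R: "ring_edge j q \<in> edges (nested_squares n)" "ring_edge j ((q + 3) mod 4) \<in> edges (nested_squares n)"
    using assms by simp_all
  have sp: "spoke v \<in> edges (nested_squares n)" if "v + 4 < 4 * (n div 4)" for v
    using that unfolding nested_squares_def by auto
  have "spoke (4 * j + q) \<in> edges (nested_squares n)" "spoke (4 * (j - 1) + q) \<in> edges (nested_squares n)"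
    by (rule sp, use assms in linarith)+
  then have S: "{4 * j + q, 4 * (j + 1) + q} \<in> edges (nested_squares n)" 
    "{4 * (j - 1) + q, 4 * j + q} \<in> edges (nested_squares n)"
    using assms(2) by (simp_all add: spoke_def algebra_simps)
  fix w assume w: "w \<in> ?W"
  then show "{4 * j + q, w} \<in> edges (nested_squares n)"
    using R S unfolding ring_edge_def q by (auto simp: insert_commute)
  consider "w = 4 * j + (q + 1) mod 4" | "w = 4 * j + (q + 3) mod 4" | "w = 4 * (j + 1) + q" | "w = 4 * (j - 1) + q"
    using w by auto
  then show "\<exists>j' q'. w = 4 * j' + q' \<and> q' < 4 \<and> j - 1 \<le> j' \<and> j' \<le> j + 1"
  proof cases
    case 1
    then have "w = 4 * j + (q + 1) mod 4 \<and> (q + 1) mod 4 < 4 \<and> j - 1 \<le> j \<and> j \<le> j + 1" by simp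
    then show ?thesis by blast
  next
    case 2
    then have "w = 4 * j + (q + 3) mod 4 \<and> (q + 3) mod 4 < 4 \<and> j - 1 \<le> j \<and> j \<le> j + 1" by simp
    then show ?thesis by blast
  next
    case 3
    then have "w = 4 * (j + 1) + q \<and> q < 4 \<and> j - 1 \<le> j + 1 \<and> j + 1 \<le> j + 1" using assms(1) by simp
    then show ?thesis by blast
  next
    case 4
    then have "w = 4 * (j - 1) + q \<and> q < 4 \<and> j - 1 \<le> j - 1 \<and> j - 1 \<le> j + 1" using assms(1) by simp
    then show ?thesis by blast
  qed
qed

text \<open>A vertex of depth at least \<open>i + 1\<close>, counted from both the innermost and the outermost square,
  has four neighbors of depth at least \<open>i\<close>. By induction all of them are outside the
  first \<open>i - 1\<close> parts, so the vertex has degree 4 in the remaining graph and is not in part \<open>i\<close>.\<close>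

lemma deep_vertices_in_late_parts:
  assumes P: "degree_partition (nested_squares n) t 3 P"
    and "1 \<le> i" "i \<le> t" "i \<le> j + 1" "j + i \<le> n div 4" "q < 4"
  shows "4 * j + q \<in> (\<Union>l\<in>{i..t}. P l)"
  using assms(2-)
proof (induction i arbitrary: j q rule: dec_induct)
  case base
  have "(\<Union>l\<in>{1..t}. P l) = verts (nested_squares n)"
    using P unfolding degree_partition_def partition_on_def by blast
  moreover have "4 * j + q < n" using base by linarith
  ultimately show ?case by (simp add: nested_squares_def)
next
  case (step i)
  let ?U = "\<Union>l\<in>{i..t}. P l"
  have v: "4 * j + q \<in> ?U" using step by simp
  obtain W where W: "card W = 4" "\<And>w. w \<in> W \<Longrightarrow> {4 * j + q, w} \<in> edges (nested_squares n)"
    "\<And>w. w \<in> W \<Longrightarrow> \<exists>j' q'. w = 4 * j' + q' \<and> q' < 4 \<and> j - 1 \<le> j' \<and> j' \<le> j + 1"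
    using inner_vertex_neighbours[of q j n] step by auto
  have "w \<in> ?U" if "w \<in> W" for w
  proof -
    obtain j' q' where "w = 4 * j' + q'" "q' < 4" "j - 1 \<le> j'" "j' \<le> j + 1" using W(3)[OF \<open>w \<in> W\<close>] by blast
    then show ?thesis using step.IH[of j' q'] step.prems step.hyps by simp
  qed
  then have "4 \<le> vdegree (induced (nested_squares n) ?U) (4 * j + q)"
    using W(1,2) v by (intro four_neighbours_vdegree[OF nested_squares_simple]) auto
  moreover have "vdegree (induced (nested_squares n) ?U) x \<le> 3" if "x \<in> P i" for x
    using P that step.hyps step.prems unfolding degree_partition_def by auto
  ultimately have "4 * j + q \<notin> P i" by force
  moreover have "{i..t} = insert i {Suc i..t}" using step.prems by auto
  ultimately show ?case using v by auto
qed

text \<open>The corner \<open>4 * t\<close> of square \<open>t\<close> is so deep that all its neighbors are with it in the last part.\<close>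

lemma nested_squares_no_degree_partition:
  assumes "1 \<le> t" "2 * t + 1 \<le> n div 4"
  shows "\<not> degree_partition (nested_squares n) t 3 P"
proof
  assume P: "degree_partition (nested_squares n) t 3 P"
  have deep: "4 * j + q \<in> P t" if "t \<le> j + 1" "j + t \<le> n div 4" "q < 4" for j q
    using deep_vertices_in_late_parts[OF P assms(1) order_refl that] by simp
  obtain W where W: "card W = 4" "\<And>w. w \<in> W \<Longrightarrow> {4 * t + 0, w} \<in> edges (nested_squares n)"
    "\<And>w. w \<in> W \<Longrightarrow> \<exists>j' q'. w = 4 * j' + q' \<and> q' < 4 \<and> t - 1 \<le> j' \<and> j' \<le> t + 1"
    using inner_vertex_neighbours[of 0 t n] assms by auto
  have v: "4 * t + 0 \<in> P t" using assms by (intro deep) auto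
  have "w \<in> P t" if "w \<in> W" for w
  proof -
    obtain j' q' where "w = 4 * j' + q'" "q' < 4" "t - 1 \<le> j'" "j' \<le> t + 1" using W(3)[OF \<open>w \<in> W\<close>] by blast
    then show ?thesis using deep[of j' q'] assms by simp
  qed
  then have "4 \<le> vdegree (induced (nested_squares n) (P t)) (4 * t + 0)"
    using W(1,2) v by (intro four_neighbours_vdegree[OF nested_squares_simple]) auto
  moreover have "\<forall>i\<in>{1..t}. \<forall>v\<in>P i. vdegree (induced (nested_squares n) (\<Union>l\<in>{i..t}. P l)) v \<le> 3"
    using P unfolding degree_partition_def by blast
  then have "\<forall>v\<in>P t. vdegree (induced (nested_squares n) (\<Union>l\<in>{t..t}. P l)) v \<le> 3"
    by (rule bspec) (use assms(1) in simp)
  then have "vdegree (induced (nested_squares n) (P t)) (4 * t + 0) \<le> 3"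
    using v by simp
  ultimately show False by simp
qed

text \<open>With \<open>s = sqrt n\<close> the left side of the second claim is at most \<open>s + 3\<close> and the right side is
  more than \<open>s ^ 2 / 4 - 1\<close>; for \<open>s \<ge> 10\<close> this is at least \<open>2.5 * s - 1\<close>.\<close>

lemma half_sqrt_parts_few:
  assumes "n \<ge> 100"
  shows "1 \<le> nat \<lceil>sqrt (real n) / 2\<rceil>" "2 * nat \<lceil>sqrt (real n) / 2\<rceil> + 1 \<le> n div 4"
proof -
  define s where "s = sqrt (real n)"
  have s: "s \<ge> 10" unfolding s_def using assms by (intro real_le_rsqrt) simp
  have ss: "s * s = real n" by (simp add: s_def)
  have c: "real_of_int \<lceil>s / 2\<rceil> < s / 2 + 1" "s / 2 \<le> real_of_int \<lceil>s / 2\<rceil>" by linarith+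
  show "1 \<le> nat \<lceil>sqrt (real n) / 2\<rceil>" using s c unfolding s_def[symmetric] by linarith
  have "10 * s \<le> real n" using s mult_right_mono[of 10 s s] ss by simp
  moreover have "n \<le> 4 * (n div 4) + 3" by presburger
  then have "real n \<le> 4 * real (n div 4) + 3" by linarith
  ultimately have "2 * real_of_int \<lceil>s / 2\<rceil> + 1 \<le> real (n div 4)" using c s by linarith
  moreover have "real (nat \<lceil>s / 2\<rceil>) = real_of_int \<lceil>s / 2\<rceil>" using s c by simp
  ultimately show "2 * nat \<lceil>sqrt (real n) / 2\<rceil> + 1 \<le> n div 4" unfolding s_def[symmetric] by linarith
qed

section \<open>Diameter and partitions\<close>

text \<open>Planarity and the absence of triangles pass to induced subgraphs, so the edge bound does.\<close>

lemma planar_triangle_free_sparse: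
  assumes "finite_simple_graph G" "planar G" "triangle_free G"
  shows "sparse G"
  unfolding sparse_def
proof (intro allI impI)
  fix U assume "U \<subseteq> verts G"
  then show "card (edges (induced G U)) \<le> 2 * card U"
    using planar_triangle_free_card_edges[of "induced G U"] finite_simple_induced planar_induced
      triangle_free_induced assms by (metis verts_induced)
qed

theorem corollary7:
  "(\<exists>p :: nat poly. \<forall>(G :: 'a graph) (k :: nat).
      finite_simple_graph G \<and> planar G \<and> triangle_free G \<and> k \<ge> 6 \<longrightarrow>
      graph_diam (recoloring_graph k G) \<le> enat (poly p (card (verts G)))) \<and>
   (\<forall>\<^sub>F n :: nat in sequentially. \<exists>G :: nat graph.
      finite_simple_graph G \<and> planar G \<and> triangle_free G \<and> card (verts G) = n \<and>
      \<not> (\<exists>P. degree_partition G (nat \<lceil>sqrt (real n) / 2\<rceil>) 3 P))"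
proof
  show "\<exists>p :: nat poly. \<forall>(G :: 'a graph) (k :: nat).
      finite_simple_graph G \<and> planar G \<and> triangle_free G \<and> k \<ge> 6 \<longrightarrow>
      graph_diam (recoloring_graph k G) \<le> enat (poly p (card (verts G)))"
  proof (intro exI[of _ "monom 1 41"] allI impI)
    fix G :: "'a graph" and k :: nat
    assume "finite_simple_graph G \<and> planar G \<and> triangle_free G \<and> k \<ge> 6"
    then have "graph_diam (recoloring_graph k G) \<le> enat (card (verts G) ^ 41)"
      using sparse_recoloring_diam planar_triangle_free_sparse by blast
    then show "graph_diam (recoloring_graph k G) \<le> enat (poly (monom 1 41) (card (verts G)))"
      by (simp add: poly_monom)
  qed
  show "\<forall>\<^sub>F n :: nat in sequentially. \<exists>G :: nat graph.
      finite_simple_graph G \<and> planar G \<and> triangle_free G \<and> card (verts G) = n \<and>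
      \<not> (\<exists>P. degree_partition G (nat \<lceil>sqrt (real n) / 2\<rceil>) 3 P)"
  proof (rule eventually_sequentiallyI[of 100])
    fix n :: nat assume "100 \<le> n"
    then have "\<not> (\<exists>P. degree_partition (nested_squares n) (nat \<lceil>sqrt (real n) / 2\<rceil>) 3 P)"
      using nested_squares_no_degree_partition half_sqrt_parts_few by blast
    moreover have "card (verts (nested_squares n)) = n" by (simp add: nested_squares_def)
    ultimately show "\<exists>G :: nat graph.
      finite_simple_graph G \<and> planar G \<and> triangle_free G \<and> card (verts G) = n \<and>
      \<not> (\<exists>P. degree_partition G (nat \<lceil>sqrt (real n) / 2\<rceil>) 3 P)"
      using nested_squares_simple nested_squares_planar nested_squares_triangle_free by blast
  qed
qed

end
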